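(* Let $u\colon A\to B$ be a bounded linear operator between two $C^*$-algebras $A$ and $B$. Then for all integers $k,n\ge1$ $$\|I_{E_n^k}\otimes u\|_{E_n^k\otimes A\to E_n^k\otimes B}\le 2^{(3k/2)-1}\,\|u\| .$$
   Context: $E_n$ is the operator space contained in $M_n\oplus M_n$ (with norm $\|(x,y)\|=\max\{\|x\|,\|y\|\}$, embedded block-diagonally in $M_{2n}$) spanned by $\delta_i=e_{i1}\oplus e_{1i}$, $i=1,\dots,n$, where $(e_{ij})$ are the matrix units of $M_n$; that is, $\sum x_i\delta_i$ is the pair whose first component has first column $(x_1,\dots,x_n)$ and zeros elsewhere, and whose second component has first row $(x_1,\dots,x_n)$ and zeros elsewhere. Tensor products of operator spaces $S\subset B(\mathcal H)$, $T\subset B(H)$ are equipped with the minimal (spatial) norm induced by $B(\mathcal H\otimes_2 H)$ (completed). $E_n^k=E_n\otimes\cdots\otimes E_n$ ($k$ times). $I_X$ denotes the identity map on $X$. *)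

theory Defs
  imports "HOL-Analysis.Analysis"
begin

class complex_vector = real_vector +
  fixes scaleC :: "complex \<Rightarrow> 'a \<Rightarrow> 'a"
  assumes scaleC_add_right: "scaleC c (x + y) = scaleC c x + scaleC c y"
    and scaleC_add_left: "scaleC (c + d) x = scaleC c x + scaleC d x"
    and scaleC_scaleC: "scaleC c (scaleC d x) = scaleC (c * d) x"
    and scaleC_of_real: "scaleC (complex_of_real r) x = scaleR r x"

class complex_normed_vector = complex_vector + real_normed_vector +
  assumes norm_scaleC: "norm (scaleC c x) = cmod c * norm x"

text \<open>The inner product is conjugate-linear in the first argument.\<close>

class complex_hilbert = complex_normed_vector + banach +
  fixes cinner :: "'a \<Rightarrow> 'a \<Rightarrow> complex"
  assumes cinner_commute: "cinner x y = cnj (cinner y x)"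
    and cinner_add_right: "cinner x (y + z) = cinner x y + cinner x z"
    and cinner_scaleC_right: "cinner x (scaleC c y) = c * cinner x y"
    and cinner_self: "cinner x x = complex_of_real ((norm x)\<^sup>2)"

text \<open>Abstract C*-algebras; no unit is required, and the zero algebra is allowed.\<close>

class cstar_algebra = complex_normed_vector + real_normed_algebra + banach +
  fixes star :: "'a \<Rightarrow> 'a"
  assumes scaleC_mult_left: "scaleC c x * y = scaleC c (x * y)"
    and scaleC_mult_right: "x * scaleC c y = scaleC c (x * y)"
    and star_star: "star (star x) = x"
    and star_add: "star (x + y) = star x + star y"
    and star_scaleC: "star (scaleC c x) = scaleC (cnj c) (star x)"
    and star_mult: "star (x * y) = star y * star x"
    and norm_star_mult_self: "norm (star x * x) = (norm x)\<^sup>2"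

definition bounded_clinear ::
    "('a::complex_normed_vector \<Rightarrow> 'b::complex_normed_vector) \<Rightarrow> bool" where
  "bounded_clinear f \<longleftrightarrow> bounded_linear f \<and> (\<forall>c x. f (scaleC c x) = scaleC c (f x))"

text \<open>
  An isometric *-representation, that is, a realization of the C*-algebra as a C*-subalgebra of
  the bounded complex-linear operators on \<open>'h\<close>. It need not be nondegenerate. The library
  type of bounded operators is only real-linear, so complex linearity of each operator
  is required separately; the norm on that type is the operator norm.
\<close>

definition cstar_embedding ::
    "('a::cstar_algebra \<Rightarrow> ('h::complex_hilbert \<Rightarrow>\<^sub>L 'h)) \<Rightarrow> bool" where
  "cstar_embedding \<pi> \<longleftrightarrow>
     (\<forall>a. bounded_clinear (blinfun_apply (\<pi> a))) \<and>
     (\<forall>a b. \<pi> (a + b) = \<pi> a + \<pi> b) \<and>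
     (\<forall>c a \<xi>. blinfun_apply (\<pi> (scaleC c a)) \<xi> = scaleC c (blinfun_apply (\<pi> a) \<xi>)) \<and>
     (\<forall>a b. \<pi> (a * b) = \<pi> a o\<^sub>L \<pi> b) \<and>
     (\<forall>a \<xi> \<eta>. cinner (blinfun_apply (\<pi> (star a)) \<xi>) \<eta> = cinner \<xi> (blinfun_apply (\<pi> a) \<eta>)) \<and>
     (\<forall>a. norm (\<pi> a) = norm a)"

text \<open>
  A matrix with rows and columns indexed by a finite set \<open>I\<close> is a function of two indices;
  only its values on \<open>I \<times> I\<close> matter. Indices of \<open>M\<^sub>n\<close> are \<open>0, \<dots>, n - 1\<close>, so the
  first row and column have index \<open>0\<close>. Block-diagonal matrices in \<open>M\<^sub>n \<oplus> M\<^sub>n \<subseteq> M\<^sub>2\<^sub>n\<close>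
  are indexed by a disjoint sum.
\<close>

type_synonym ('i, 'a) matr = "'i \<Rightarrow> 'i \<Rightarrow> 'a"

definition matrix_unit :: "'i \<Rightarrow> 'i \<Rightarrow> ('i, complex) matr" where
  "matrix_unit i j = (\<lambda>p q. if p = i \<and> q = j then 1 else 0)"

fun block_diag :: "('i, complex) matr \<Rightarrow> ('j, complex) matr \<Rightarrow> ('i + 'j, complex) matr" where
  "block_diag X Y (Inl p) (Inl q) = X p q"
| "block_diag X Y (Inr p) (Inr q) = Y p q"
| "block_diag X Y (Inl p) (Inr q) = 0"
| "block_diag X Y (Inr p) (Inl q) = 0"

definition delta :: "nat \<Rightarrow> (nat + nat, complex) matr" where
  "delta i = block_diag (matrix_unit i 0) (matrix_unit 0 i)"

definition E_space :: "nat \<Rightarrow> (nat + nat, complex) matr set" where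
  "E_space n = {(\<lambda>p q. \<Sum>i<n. c i * delta i p q) | c. True}"

text \<open>
  The tensor power \<open>M\<^sub>2\<^sub>n \<otimes> \<dots> \<otimes> M\<^sub>2\<^sub>n\<close> acts on the \<open>k\<close>-fold Hilbert space tensor power of
  \<open>\<complex>\<^sup>n \<oplus> \<complex>\<^sup>n\<close>, whose canonical orthonormal basis is indexed by lists of length \<open>k\<close>.
  All tensor products below have a finite-dimensional factor, so the algebraic
  tensor product is already complete.
\<close>

definition E_index :: "nat \<Rightarrow> nat \<Rightarrow> (nat + nat) list set" where
  "E_index n k = {p. length p = k \<and> set p \<subseteq> {..<n} <+> {..<n}}"

definition pure_tensor :: "nat \<Rightarrow> (nat \<Rightarrow> ('i, complex) matr) \<Rightarrow> ('i list, complex) matr" where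
  "pure_tensor k X = (\<lambda>p q. \<Prod>r<k. X r (p ! r) (q ! r))"

definition E_power :: "nat \<Rightarrow> nat \<Rightarrow> ((nat + nat) list, complex) matr set" where
  "E_power n k =
     {(\<lambda>p q. \<Sum>j<m. c j * pure_tensor k (X j) p q) | (m::nat) c X.
        \<forall>j<m. \<forall>r<k. X j r \<in> E_space n}"

definition tensor :: "('i, complex) matr \<Rightarrow> 'a::complex_vector \<Rightarrow> ('i, 'a) matr" where
  "tensor Y a = (\<lambda>p q. scaleC (Y p q) a)"

text \<open>\<open>S \<otimes> A\<close> for a space \<open>S\<close> of scalar matrices and the whole algebra \<open>A = 'a\<close>\<close>

definition tensor_space :: "('i, complex) matr set \<Rightarrow> ('i, 'a::complex_vector) matr set" where
  "tensor_space S = {(\<lambda>p q. \<Sum>j<m. tensor (Y j) (a j) p q) | (m::nat) Y a. \<forall>j<m. Y j \<in> S}"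

text \<open>
  The minimal norm: for a matrix over \<open>A\<close> represented by \<open>\<pi>\<close> on \<open>H\<close>, the norm as an operator on
  \<open>\<ell>\<^sub>2(I) \<otimes>\<^sub>2 H\<close>, which is the space of families \<open>(\<xi> q)\<close>, \<open>q \<in> I\<close>, in \<open>H\<close> with the
  \<open>\<ell>\<^sub>2\<close>-norm. For finite \<open>I\<close> the supremum is over a nonempty bounded set.
\<close>

definition min_norm ::
    "'i set \<Rightarrow> ('a \<Rightarrow> ('h::real_normed_vector \<Rightarrow>\<^sub>L 'h)) \<Rightarrow> ('i, 'a) matr \<Rightarrow> real" where
  "min_norm I \<pi> x =
     (SUP \<xi>\<in>{\<xi>. L2_set (\<lambda>q. norm (\<xi> q)) I \<le> 1}.
        L2_set (\<lambda>p. norm (\<Sum>q\<in>I. blinfun_apply (\<pi> (x p q)) (\<xi> q))) I)"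

text \<open>
  The map \<open>I \<otimes> u\<close> is entrywise application of \<open>u\<close>; the lemma after the definition
  shows that it is determined by \<open>Y \<otimes> a \<mapsto> Y \<otimes> u a\<close>.
\<close>

definition amplify :: "('a \<Rightarrow> 'b) \<Rightarrow> ('i, 'a) matr \<Rightarrow> ('i, 'b) matr" where
  "amplify u x = (\<lambda>p q. u (x p q))"

lemma amplify_sum_tensor:
  assumes "bounded_clinear u"
  shows "amplify u (\<lambda>p q. \<Sum>j<(m::nat). tensor (Y j) (a j) p q)
       = (\<lambda>p q. \<Sum>j<m. tensor (Y j) (u (a j)) p q)"
proof -
  have "linear u" and "\<And>c x. u (scaleC c x) = scaleC c (u x)"
    using assms by (auto simp: bounded_clinear_def bounded_linear.linear)
  then show ?thesis
    by (simp add: amplify_def tensor_def linear_sum)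
qed

text \<open>Extended-real-valued, so that an unbounded map has norm \<open>\<infinity>\<close>.\<close>

definition map_norm ::
    "'x set \<Rightarrow> ('x \<Rightarrow> real) \<Rightarrow> ('y \<Rightarrow> real) \<Rightarrow> ('x \<Rightarrow> 'y) \<Rightarrow> ereal" where
  "map_norm V N N' T = (SUP x\<in>{x \<in> V. N x \<le> 1}. ereal (N' (T x)))"

end

theory Submission
  imports Defs "HOL-Library.Function_Algebras"
begin

text \<open>
  For \<open>k = 1\<close> the bound is the little Grothendieck inequality with Haagerup's constants: a
  linear map \<open>v\<close> from a C*-algebra to a Hilbert space satisfies
  \<open>\<Sum> \<parallel>v a\<^sub>i\<parallel>\<^sup>2 \<le> \<parallel>v\<parallel>\<^sup>2 (\<parallel>\<Sum> a\<^sub>i* a\<^sub>i\<parallel> + \<parallel>\<Sum> a\<^sub>i a\<^sub>i*\<parallel>)\<close>, and both sums are at most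
  \<open>\<parallel>\<Sum> \<delta>\<^sub>i \<otimes> a\<^sub>i\<parallel>\<^sup>2\<close>. To avoid unitaries, the inequality is obtained from the second
  variation of \<open>\<parallel>v\<parallel>\<^sup>2\<close> along operator Moebius curves in the unit ball through a nearly
  norm-attaining point; this works in any *-algebra of operators, complete and unital or not.

  For larger \<open>k\<close>, let \<open>G\<close> be the free product of copies of \<open>\<int>/2\<close> with generators \<open>g\<^sub>i\<close>.
  Taking the coefficients at the \<open>g\<^sub>i\<close> maps \<open>A[G]\<close> completely contractively onto \<open>E\<^sub>n \<otimes> A\<close>:
  since \<open>g\<^sub>i\<close> is an involution, these coefficients form part of a column and part of a row
  of the same operator matrix. Conversely \<open>\<delta>\<^sub>i \<mapsto> \<lambda>(g\<^sub>i)\<close> has completely bounded norm at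
  most \<open>2\<close>. Replacing \<open>k - 1\<close> tensor factors by group elements costs \<open>2\<^bsup>k-1\<^esup>\<close>, and
  \<open>k\<close> applications of the inequality cost \<open>2\<^bsup>k/2\<^esup>\<close>.
\<close>

text \<open>The inequality needs a star algebra as its domain. In general \<open>E_n^k\<close>
  tensored with A is not one, so after the first application there would be nothing to iterate on;
  the group algebra supplies a domain in which the remaining factors can wait. One factor needs no
  lifting: it is read directly as a column and a row of coefficients, the form of input that the
  inequality takes. This saves one factor 2 and explains the exponent k/2 + (k - 1).

  Second variation: if x in the unit ball nearly maximises the norm of v, then up to a small error
  the squared norm of v a is at most Re <v x, v (a a* x + x a* a)>. One x serves all a_i, so the sum
  moves inside v, where the sums of a_i a_i* and of a_i* a_i appear as operators.

  Multiplication in G is never defined. An element of A[G^j] is a matrix over tuples of reduced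
  words, invariant under right multiplication by generators, and its product is the ordinary matrix
  product. Finite truncations and finitely supported vectors carry all estimates, so neither the
  Hilbert space nor the algebra is completed.\<close>

instantiation "fun" :: (type, real_vector) real_vector
begin

definition scaleR_fun_def: "scaleR r f = (\<lambda>x. r *\<^sub>R f x)"

instance
  by standard (auto simp: scaleR_fun_def fun_eq_iff scaleR_add_left scaleR_add_right)

end

lemma scaleR_fun_apply [simp]: "(r *\<^sub>R f) x = r *\<^sub>R f x"
  by (simp add: scaleR_fun_def)

section \<open>Inner products\<close>

lemma scaleC_zero_right [simp]: "scaleC c (0::'a::complex_vector) = 0"
  using scaleC_add_right[of c 0 0] by simp

lemma scaleC_zero_left [simp]: "scaleC 0 (x::'a::complex_vector) = 0"
  using scaleC_add_left[of 0 0 x] by simp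

lemma scaleC_one [simp]: "scaleC 1 (x::'a::complex_vector) = x"
  using scaleC_of_real[of 1 x] by simp

lemma scaleC_minus_one [simp]: "scaleC (-1) (x::'a::complex_vector) = - x"
  using scaleC_of_real[of "-1" x] by simp

lemma scaleC_scaleR: "scaleC c (r *\<^sub>R x) = r *\<^sub>R scaleC c (x::'a::complex_vector)"
  by (metis mult.commute scaleC_of_real scaleC_scaleC)

lemma scaleC_minus_right: "scaleC c (- x) = - scaleC c (x::'a::complex_vector)"
  using scaleC_scaleR[of c "-1" x] by simp

lemma scaleC_sum_right: "scaleC c (sum f S) = (\<Sum>x\<in>S. scaleC c (f x :: 'a::complex_vector))"
  by (induction S rule: infinite_finite_induct) (auto simp: scaleC_add_right)

lemma scaleC_sum_left: "scaleC (sum f S) (y :: 'a::complex_vector) = (\<Sum>x\<in>S. scaleC (f x) y)"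
  by (induction S rule: infinite_finite_induct) (auto simp: scaleC_add_left)

text \<open>The underlying real Hilbert space has the same norm, and complex adjoints remain
  adjoints for it. The analysis can then run over \<open>real_inner\<close>, with the complex
  structure entering only through multiplication by the imaginary unit.\<close>

definition rinner :: "'h::complex_hilbert \<Rightarrow> 'h \<Rightarrow> real" where
  "rinner x y = Re (cinner x y)"

lemma rinner_commute: "rinner x y = rinner y x"
  unfolding rinner_def by (subst cinner_commute) simp

lemma rinner_add_right: "rinner x (y + z) = rinner x y + rinner x z"
  by (simp add: rinner_def cinner_add_right)

lemma rinner_add_left: "rinner (x + y) z = rinner x z + rinner y z"
  by (metis rinner_add_right rinner_commute)

lemma rinner_scaleR_right: "rinner x (r *\<^sub>R y) = r * rinner x y"
  by (simp add: rinner_def cinner_scaleC_right flip: scaleC_of_real)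

lemma rinner_scaleR_left: "rinner (r *\<^sub>R x) y = r * rinner x y"
  by (metis rinner_scaleR_right rinner_commute)

lemma rinner_zero [simp]: "rinner 0 x = 0" "rinner x 0 = 0"
  using rinner_scaleR_left[of 0 0 x] rinner_scaleR_right[of x 0 0] by auto

lemma rinner_sum_right: "rinner x (sum f S) = (\<Sum>i\<in>S. rinner x (f i))"
  by (induction S rule: infinite_finite_induct) (auto simp: rinner_add_right)

lemma rinner_sum_left: "rinner (sum f S) x = (\<Sum>i\<in>S. rinner (f i) x)"
  by (induction S rule: infinite_finite_induct) (auto simp: rinner_add_left)

lemma rinner_self: "rinner x x = (norm x)\<^sup>2"
  by (simp add: rinner_def cinner_self)

lemma rinner_le_norm: "rinner x y \<le> norm x * norm y"
proof -
  have "(norm (x + y))\<^sup>2 \<le> (norm x + norm y)\<^sup>2"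
    by (intro power_mono norm_triangle_ineq) auto
  moreover have "(norm (x + y))\<^sup>2 = (norm x)\<^sup>2 + 2 * rinner x y + (norm y)\<^sup>2"
    by (simp add: rinner_add_left rinner_add_right rinner_commute[of y x] flip: rinner_self)
  ultimately show ?thesis
    by (simp add: power2_sum)
qed

section \<open>Finitely supported families of vectors\<close>

text \<open>A pre-Hilbert space suffices: matrices with finite rows and columns preserve finite
  support, and the inequality below is proved for operators on any \<open>real_inner\<close>
  space.\<close>

typedef (overloaded) ('i, 'h) fsv = "{f :: 'i \<Rightarrow> 'h::complex_hilbert. finite {p. f p \<noteq> 0}}"
  by (rule exI[of _ "\<lambda>_. 0"]) auto

setup_lifting type_definition_fsv

lift_definition fsv_nth :: "('i, 'h::complex_hilbert) fsv \<Rightarrow> 'i \<Rightarrow> 'h" is "\<lambda>f. f" .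

definition supp :: "('i, 'h::complex_hilbert) fsv \<Rightarrow> 'i set" where
  "supp \<xi> = {p. fsv_nth \<xi> p \<noteq> 0}"

lemma finite_supp [simp]: "finite (supp \<xi>)"
  unfolding supp_def by transfer auto

lemma fsv_eqI: "(\<And>p. fsv_nth \<xi> p = fsv_nth \<eta> p) \<Longrightarrow> \<xi> = \<eta>"
  by transfer auto

lemma fsv_nth_Abs: "finite {p. f p \<noteq> 0} \<Longrightarrow> fsv_nth (Abs_fsv f) = f"
  by (simp add: Abs_fsv_inverse fsv_nth.rep_eq)

instantiation fsv :: (type, complex_hilbert) real_vector
begin

lift_definition zero_fsv :: "('a, 'b) fsv" is "\<lambda>_. 0" by simp

lift_definition plus_fsv :: "('a, 'b) fsv \<Rightarrow> ('a, 'b) fsv \<Rightarrow> ('a, 'b) fsv"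
  is "\<lambda>f g p. f p + g p"
  subgoal for f g by (rule finite_subset[of _ "{p. f p \<noteq> 0} \<union> {p. g p \<noteq> 0}"]) auto
  done

lift_definition minus_fsv :: "('a, 'b) fsv \<Rightarrow> ('a, 'b) fsv \<Rightarrow> ('a, 'b) fsv"
  is "\<lambda>f g p. f p - g p"
  subgoal for f g by (rule finite_subset[of _ "{p. f p \<noteq> 0} \<union> {p. g p \<noteq> 0}"]) auto
  done

lift_definition uminus_fsv :: "('a, 'b) fsv \<Rightarrow> ('a, 'b) fsv" is "\<lambda>f p. - f p"
  by simp

lift_definition scaleR_fsv :: "real \<Rightarrow> ('a, 'b) fsv \<Rightarrow> ('a, 'b) fsv" is "\<lambda>r f p. r *\<^sub>R f p"
  subgoal for r f by (rule finite_subset[of _ "{p. f p \<noteq> 0}"]) auto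
  done

instance
  by standard (transfer; simp add: algebra_simps)+

end

lemma fsv_nth_simps [simp]:
  "fsv_nth 0 p = 0" "fsv_nth (x + y) p = fsv_nth x p + fsv_nth y p"
  "fsv_nth (x - y) p = fsv_nth x p - fsv_nth y p"
  "fsv_nth (- x) p = - fsv_nth x p"
  "fsv_nth (r *\<^sub>R x) p = r *\<^sub>R fsv_nth x p"
  by (transfer; auto)+

instantiation fsv :: (type, complex_hilbert) real_inner
begin

definition inner_fsv :: "('a, 'b) fsv \<Rightarrow> ('a, 'b) fsv \<Rightarrow> real" where
  "inner_fsv f g = (\<Sum>p\<in>supp f. rinner (fsv_nth f p) (fsv_nth g p))"

definition "norm (f :: ('a, 'b) fsv) = sqrt (inner f f)"
definition "sgn (f :: ('a, 'b) fsv) = f /\<^sub>R norm f"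
definition "dist (f :: ('a, 'b) fsv) g = norm (f - g)"
definition [code del]: "(uniformity :: (('a, 'b) fsv \<times> ('a, 'b) fsv) filter) =
  (INF e\<in>{0<..}. principal {(x, y). dist x y < e})"
definition [code del]: "open (U :: ('a, 'b) fsv set) \<longleftrightarrow>
  (\<forall>x\<in>U. \<forall>\<^sub>F (x', y) in uniformity. x' = x \<longrightarrow> y \<in> U)"

lemma inner_fsv_eq:
  fixes f g :: "('a, 'b) fsv"
  assumes "finite D" "supp f \<subseteq> D"
  shows "inner f g = (\<Sum>p\<in>D. rinner (fsv_nth f p) (fsv_nth g p))"
  unfolding inner_fsv_def
  by (rule sum.mono_neutral_left) (use assms in \<open>auto simp: supp_def\<close>)

instance
proof
  fix x y z :: "('a, 'b) fsv" and r :: real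
  have "supp (x + y) \<subseteq> supp x \<union> supp y"
    by (auto simp: supp_def)
  then show "inner (x + y) z = inner x z + inner y z"
    by (simp add: inner_fsv_eq[of "supp x \<union> supp y"] rinner_add_left sum.distrib)
  show "inner x y = inner y x"
    by (simp add: inner_fsv_eq[of "supp x \<union> supp y"] rinner_commute)
  have "supp (r *\<^sub>R x) \<subseteq> supp x"
    by (auto simp: supp_def)
  then show "inner (r *\<^sub>R x) y = r * inner x y"
    by (simp add: inner_fsv_eq[of "supp x"] rinner_scaleR_left sum_distrib_left)
  show "0 \<le> inner x x"
    by (auto simp: inner_fsv_def rinner_self intro!: sum_nonneg)
  show "inner x x = 0 \<longleftrightarrow> x = 0"
  proof
    assume "inner x x = 0"
    then have "\<forall>p\<in>supp x. fsv_nth x p = 0"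
      by (simp add: inner_fsv_def rinner_self sum_nonneg_eq_0_iff)
    then show "x = 0"
      by (auto simp: supp_def intro!: fsv_eqI)
  qed (simp add: inner_fsv_def)
qed (simp_all only: norm_fsv_def sgn_fsv_def dist_fsv_def uniformity_fsv_def open_fsv_def)

end

lemma norm_fsv_power2:
  assumes "finite D" "supp f \<subseteq> D"
  shows "(norm f)\<^sup>2 = (\<Sum>p\<in>D. (norm (fsv_nth f p))\<^sup>2)"
  using inner_fsv_eq[OF assms, of f] by (simp add: power2_norm_eq_inner rinner_self)

section \<open>The little Grothendieck inequality\<close>

text \<open>Pairing \<open>bs \<xi>\<close> with itself and moving \<open>bs\<close> across gives
  its squared norm; Cauchy-Schwarz then lets one factor cancel.\<close>

lemma norm_adjoint_le:
  fixes b bs :: "'v::real_inner \<Rightarrow> 'v"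
  assumes adj: "\<And>\<xi> \<eta>. inner (bs \<xi>) \<eta> = inner \<xi> (b \<eta>)"
    and bd: "\<And>\<xi>. norm (b \<xi>) \<le> s * norm \<xi>" and "0 \<le> s"
  shows "norm (bs \<xi>) \<le> s * norm \<xi>"
proof (cases "norm (bs \<xi>) = 0")
  case False
  have "norm (bs \<xi>) * norm (bs \<xi>) = inner \<xi> (b (bs \<xi>))"
    by (simp add: power2_norm_eq_inner flip: power2_eq_square adj)
  also have "\<dots> \<le> norm \<xi> * norm (b (bs \<xi>))"
    by (rule norm_cauchy_schwarz)
  also have "\<dots> \<le> norm \<xi> * (s * norm (bs \<xi>))"
    by (intro mult_left_mono bd) auto
  finally have "norm (bs \<xi>) * norm (bs \<xi>) \<le> (s * norm \<xi>) * norm (bs \<xi>)"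
    by (simp add: mult_ac)
  then show ?thesis
    using False by (simp add: mult_le_cancel_right)
qed (use \<open>0 \<le> s\<close> in simp)

text \<open>
  The vector on the left is \<open>y \<eta>\<close>, where \<open>y\<close> is the second-order Taylor polynomial in \<open>b\<close> of
  the Moebius transform \<open>(1 - b b*)\<^bsup>-1/2\<^esup> (x + b) (1 + b* x)\<^bsup>-1\<^esup> (1 - b* b)\<^bsup>1/2\<^esup>\<close> of \<open>x\<close>.
  The matrix with rows \<open>(1 + b b*/2, b)\<close> and \<open>(b*, 1 + b* b/2)\<close> preserves the
  form \<open>\<parallel>\<cdot>\<parallel>\<^sup>2 - \<parallel>\<cdot>\<parallel>\<^sup>2\<close> up to fourth order; it is applied to \<open>(x \<zeta>, \<zeta>)\<close>, with \<open>\<zeta>\<close> chosen so that the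
  image \<open>(A1, A2)\<close> is \<open>(y \<eta>, \<eta>)\<close> up to third order.
\<close>

lemma moebius_contraction:
  fixes x xs b bs :: "'v::real_inner \<Rightarrow> 'v"
  assumes lin: "linear x" "linear b" "linear bs"
    and adjb: "\<And>\<xi> \<eta>. inner (bs \<xi>) \<eta> = inner \<xi> (b \<eta>)"
    and x1: "\<And>\<xi>. norm (x \<xi>) \<le> norm \<xi>"
    and bs: "\<And>\<xi>. norm (b \<xi>) \<le> s * norm \<xi>"
    and s: "0 \<le> s" "s \<le> 1"
  shows "(norm (x \<eta> + (b \<eta> - x (bs (x \<eta>)))
             + (x (bs (x (bs (x \<eta>)))) - (1/2) *\<^sub>R (b (bs (x \<eta>)) + x (bs (b \<eta>))))))\<^sup>2
         \<le> (1 + 50 * s ^ 3) * (norm \<eta>)\<^sup>2" (is "(norm ?y)\<^sup>2 \<le> _")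
proof -
  define h where "h = norm \<eta>"
  have h0: "0 \<le> h" by (simp add: h_def)
  note linX = linear_add[OF lin(1)] linear_add[OF lin(2)] linear_add[OF lin(3)]
     linear_diff[OF lin(1)] linear_diff[OF lin(2)] linear_diff[OF lin(3)]
     linear_scale[OF lin(1)] linear_scale[OF lin(2)] linear_scale[OF lin(3)]
  have bss: "norm (bs \<xi>) \<le> s * norm \<xi>" for \<xi>
    by (rule norm_adjoint_le[OF adjb bs s(1)])
  have nx: "norm (x \<xi>) \<le> c" if "norm \<xi> \<le> c" for \<xi> c
    using x1[of \<xi>] that by linarith
  have nb: "norm (b \<xi>) \<le> s * c" if "norm \<xi> \<le> c" for \<xi> c
    using bs[of \<xi>] mult_left_mono[OF that s(1)] by linarith
  have nbs: "norm (bs \<xi>) \<le> s * c" if "norm \<xi> \<le> c" for \<xi> c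
    using bss[of \<xi>] mult_left_mono[OF that s(1)] by linarith
  have e0: "norm \<eta> \<le> h" by (simp add: h_def)
  have s3: "s ^ m * h \<le> s ^ 3 * h" if "3 \<le> m" for m
    using power_decreasing[OF that s] h0 by (intro mult_right_mono) auto
  have s0: "s ^ m * h \<le> h" for m
    using mult_right_mono[OF power_le_one[OF s, of m] h0] by simp

  have s30: "0 \<le> s ^ 3 * h"
    using s h0 by simp

  \<comment> \<open>Up to third order this is (1 - b* x + b* x b* x)(1 - b* b/2) applied to
    \<open>\<eta>\<close>, an approximate inverse of the map from \<open>\<zeta>\<close> to
    \<open>A2\<close>.\<close>
  define \<zeta> where "\<zeta> = \<eta> - bs (x \<eta>) - (1/2) *\<^sub>R bs (b \<eta>) + bs (x (bs (x \<eta>)))"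
  define X where "X = x \<zeta>"
  define A1 where "A1 = X + b \<zeta> + (1/2) *\<^sub>R b (bs X)"
  define A2 where "A2 = \<zeta> + bs X + (1/2) *\<^sub>R bs (b \<zeta>)"
  \<comment> \<open>The remainders \<open>R1\<close> and \<open>R2\<close> collect what is left;
    each term contains at least three factors \<open>b\<close> or \<open>bs\<close>, hence is
    bounded by a multiple of \<open>s ^ 3\<close>.\<close>
  define R1 where "R1 = - ((1/2) *\<^sub>R b (bs (b \<eta>))) + (1/2) *\<^sub>R b (bs (x (bs (x \<eta>))))
      - (1/4) *\<^sub>R b (bs (x (bs (b \<eta>)))) + (1/2) *\<^sub>R b (bs (x (bs (x (bs (x \<eta>))))))"
  define R2 where "R2 = - ((1/2) *\<^sub>R bs (x (bs (b \<eta>)))) + bs (x (bs (x (bs (x \<eta>)))))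
      - (1/2) *\<^sub>R bs (b (bs (x \<eta>))) - (1/4) *\<^sub>R bs (b (bs (b \<eta>)))
      + (1/2) *\<^sub>R bs (b (bs (x (bs (x \<eta>)))))"
  have A1: "A1 = ?y + R1"
    unfolding A1_def R1_def X_def \<zeta>_def
    by (simp add: linX algebra_simps) (simp flip: scaleR_add_left add.assoc)
  have A2: "A2 = \<eta> + R2"
    unfolding A2_def R2_def X_def \<zeta>_def
    by (simp add: linX algebra_simps)

  have "norm R2 \<le> 3 * (s ^ 3 * h)"
  proof -
    have 1: "norm (bs (x (bs (b \<eta>)))) \<le> s ^ 3 * h"
      using nbs[OF nx[OF nbs[OF nb[OF e0]]]] by (simp add: power3_eq_cube mult_ac)
    have 2: "norm (bs (x (bs (x (bs (x \<eta>)))))) \<le> s ^ 3 * h"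
      using nbs[OF nx[OF nbs[OF nx[OF nbs[OF nx[OF e0]]]]]] by (simp add: power3_eq_cube mult_ac)
    have 3: "norm (bs (b (bs (x \<eta>)))) \<le> s ^ 3 * h"
      using nbs[OF nb[OF nbs[OF nx[OF e0]]]] by (simp add: power3_eq_cube mult_ac)
    have 4: "norm (bs (b (bs (b \<eta>)))) \<le> s ^ 3 * h"
      using nbs[OF nb[OF nbs[OF nb[OF e0]]]] s3[of 4] by (simp add: power4_eq_xxxx mult_ac)
    have 5: "norm (bs (b (bs (x (bs (x \<eta>)))))) \<le> s ^ 3 * h"
      using nbs[OF nb[OF nbs[OF nx[OF nbs[OF nx[OF e0]]]]]] s3[of 4]
      by (simp add: power4_eq_xxxx mult_ac)
    have "norm R2 \<le> (1/2) * norm (bs (x (bs (b \<eta>)))) + norm (bs (x (bs (x (bs (x \<eta>))))))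
        + (1/2) * norm (bs (b (bs (x \<eta>)))) + (1/4) * norm (bs (b (bs (b \<eta>))))
        + (1/2) * norm (bs (b (bs (x (bs (x \<eta>))))))"
      unfolding R2_def by (rule norm_triangle_mono norm_triangle_le_diff order_refl
          | simp add: norm_triangle_mono)+
    then show ?thesis
      using 1 2 3 4 5 s30 by linarith
  qed
  moreover have "norm R1 \<le> 2 * (s ^ 3 * h)"
  proof -
    have 1: "norm (b (bs (b \<eta>))) \<le> s ^ 3 * h"
      using nb[OF nbs[OF nb[OF e0]]] by (simp add: power3_eq_cube mult_ac)
    have 2: "norm (b (bs (x (bs (x \<eta>))))) \<le> s ^ 3 * h"
      using nb[OF nbs[OF nx[OF nbs[OF nx[OF e0]]]]] by (simp add: power3_eq_cube mult_ac)
    have 3: "norm (b (bs (x (bs (b \<eta>))))) \<le> s ^ 3 * h"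
      using nb[OF nbs[OF nx[OF nbs[OF nb[OF e0]]]]] s3[of 4] by (simp add: power4_eq_xxxx mult_ac)
    have 4: "norm (b (bs (x (bs (x (bs (x \<eta>))))))) \<le> s ^ 3 * h"
      using nb[OF nbs[OF nx[OF nbs[OF nx[OF nbs[OF nx[OF e0]]]]]]] s3[of 4]
      by (simp add: power4_eq_xxxx mult_ac)
    have "norm R1 \<le> (1/2) * norm (b (bs (b \<eta>))) + (1/2) * norm (b (bs (x (bs (x \<eta>)))))
        + (1/4) * norm (b (bs (x (bs (b \<eta>))))) + (1/2) * norm (b (bs (x (bs (x (bs (x \<eta>)))))))"
      unfolding R1_def by (rule norm_triangle_mono norm_triangle_le_diff order_refl
          | simp add: norm_triangle_mono)+
    then show ?thesis
      using 1 2 3 4 s30 by linarith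
  qed
  moreover have "norm \<zeta> \<le> 4 * h"
  proof -
    have 1: "norm (bs (x \<eta>)) \<le> h"
      using nbs[OF nx[OF e0]] s0[of 1] by simp
    have 2: "norm (bs (b \<eta>)) \<le> h"
      using nbs[OF nb[OF e0]] s0[of 2] by (simp add: power2_eq_square mult_ac)
    have 3: "norm (bs (x (bs (x \<eta>)))) \<le> h"
      using nbs[OF nx[OF nbs[OF nx[OF e0]]]] s0[of 2] by (simp add: power2_eq_square mult_ac)
    have "norm \<zeta> \<le> norm \<eta> + norm (bs (x \<eta>)) + (1/2) * norm (bs (b \<eta>)) + norm (bs (x (bs (x \<eta>))))"
      unfolding \<zeta>_def by (rule norm_triangle_mono norm_triangle_le_diff order_refl
          | simp add: norm_triangle_mono)+
    then show ?thesis
      using 1 2 3 e0 h0 by linarith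
  qed
  moreover have "(norm A1)\<^sup>2 \<le> (norm A2)\<^sup>2 + (1/4) * (s\<^sup>2 * norm \<zeta>)\<^sup>2"
  proof -
    have adj': "inner \<xi> (bs \<eta>) = inner (b \<xi>) \<eta>" for \<xi> \<eta>
      by (metis adjb inner_commute)
    \<comment> \<open>The mixed terms and those quadratic in \<open>b\<close> agree on both sides by
      adjointness. Only terms of fourth order in \<open>b\<close> are left, besides the contraction
      defect of \<open>x\<close> at \<open>\<zeta>\<close>.\<close>
    have "(norm A1)\<^sup>2 - (norm A2)\<^sup>2
        = (norm X)\<^sup>2 - (norm \<zeta>)\<^sup>2 + (1/4) * ((norm (b (bs X)))\<^sup>2 - (norm (bs (b \<zeta>)))\<^sup>2)"
      unfolding A1_def A2_def power2_norm_eq_inner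
      by (simp add: inner_add_left inner_add_right algebra_simps adjb adj' inner_commute)
    also have "\<dots> \<le> (1/4) * (norm (b (bs X)))\<^sup>2"
      using power_mono[OF x1[of \<zeta>] norm_ge_zero, of 2] zero_le_power2[of "norm (bs (b \<zeta>))"]
      unfolding X_def right_diff_distrib by linarith
    also have "\<dots> \<le> (1/4) * (s\<^sup>2 * norm \<zeta>)\<^sup>2"
      using nb[OF nbs[OF nx[of \<zeta>, OF order_refl]]]
      by (intro mult_left_mono power_mono) (auto simp: X_def power2_eq_square mult_ac)
    finally show ?thesis by linarith
  qed
  ultimately have R2: "norm R2 \<le> 3 * (s ^ 3 * h)" and R1: "norm R1 \<le> 2 * (s ^ 3 * h)"
    and z: "norm \<zeta> \<le> 4 * h" and A12: "(norm A1)\<^sup>2 \<le> (norm A2)\<^sup>2 + (1/4) * (s\<^sup>2 * norm \<zeta>)\<^sup>2"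
    by blast+
  define c where "c = s ^ 3"
  have c: "0 \<le> c" "c \<le> 1" "s ^ 4 \<le> c"
    using s power_decreasing[of 3 4 s] by (auto simp: c_def power_le_one)
  have cc: "c\<^sup>2 \<le> c"
    using c by (simp add: power2_eq_square mult_left_le)
  have "norm A2 \<le> (1 + 3 * c) * h"
    using norm_triangle_ineq[of \<eta> R2] R2 by (simp add: A2 h_def c_def algebra_simps)
  then have "(norm A2)\<^sup>2 \<le> (1 + 3 * c)\<^sup>2 * h\<^sup>2"
    by (metis norm_ge_zero power_mono power_mult_distrib)
  moreover have "(s\<^sup>2 * norm \<zeta>)\<^sup>2 \<le> 16 * c * h\<^sup>2"
  proof -
    have "(s\<^sup>2 * norm \<zeta>)\<^sup>2 \<le> (s\<^sup>2 * (4 * h))\<^sup>2"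
      by (intro power_mono mult_left_mono z) auto
    also have "\<dots> = s ^ 4 * (16 * h\<^sup>2)"
      by (simp add: power_mult_distrib flip: power_mult)
    also have "\<dots> \<le> c * (16 * h\<^sup>2)"
      by (intro mult_right_mono c) auto
    finally show ?thesis by simp
  qed
  ultimately have "(norm A1)\<^sup>2 \<le> ((1 + 3 * c)\<^sup>2 + 4 * c) * h\<^sup>2"
    using A12 by (simp add: algebra_simps)
  also have "\<dots> \<le> (1 + 19 * c) * h\<^sup>2"
    using cc by (intro mult_right_mono) (auto simp: power2_eq_square algebra_simps)
  finally have A1': "(norm A1)\<^sup>2 \<le> (1 + 19 * c) * h\<^sup>2" .
  also have "\<dots> \<le> (5 * h)\<^sup>2"
    unfolding power_mult_distrib using c by (intro mult_right_mono) auto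
  finally have A1h: "norm A1 \<le> 5 * h"
    by (rule power2_le_imp_le) (use h0 in auto)
  have "norm ?y \<le> norm A1 + 2 * (c * h)"
    using norm_triangle_ineq4[of A1 R1] R1 by (simp add: A1 c_def)
  then have "(norm ?y)\<^sup>2 \<le> (norm A1 + 2 * (c * h))\<^sup>2"
    by (intro power_mono) auto
  also have "\<dots> = (norm A1)\<^sup>2 + 4 * (c * h) * norm A1 + 4 * (c\<^sup>2 * h\<^sup>2)"
    by (simp add: power2_sum power_mult_distrib)
  also have "\<dots> \<le> (1 + 19 * c) * h\<^sup>2 + 4 * (c * h) * (5 * h) + 4 * (c * h\<^sup>2)"
    using A1' A1h c h0 cc by (intro add_mono mult_left_mono mult_right_mono) auto
  \<comment> \<open>43 = 19 + 20 + 4, rounded up to 50 next. Only the cubic order matters, since the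
    estimate will be divided by the square of the step.\<close>
  also have "\<dots> = (1 + 43 * c) * h\<^sup>2"
    by (simp add: power2_eq_square algebra_simps)
  also have "\<dots> \<le> (1 + 50 * c) * h\<^sup>2"
    using c by (intro mult_right_mono) auto
  finally show ?thesis
    by (simp add: c_def h_def)
qed

text \<open>\<open>J\<close> is multiplication by the imaginary unit; all other scalars are real.\<close>

locale star_algebra_rep =
  fixes C :: "'c::real_vector set" and mul :: "'c \<Rightarrow> 'c \<Rightarrow> 'c" and st J :: "'c \<Rightarrow> 'c"
    and op :: "'c \<Rightarrow> 'v::real_inner \<Rightarrow> 'v"
  assumes sub: "subspace C"
    and mul_in: "x \<in> C \<Longrightarrow> y \<in> C \<Longrightarrow> mul x y \<in> C"
    and st_in: "x \<in> C \<Longrightarrow> st x \<in> C"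
    and J_in: "x \<in> C \<Longrightarrow> J x \<in> C"
    and mul_minus_right: "x \<in> C \<Longrightarrow> y \<in> C \<Longrightarrow> mul x (- y) = - mul x y"
    and mul_minus_left: "x \<in> C \<Longrightarrow> y \<in> C \<Longrightarrow> mul (- x) y = - mul x y"
    and mul_J_right: "x \<in> C \<Longrightarrow> y \<in> C \<Longrightarrow> mul x (J y) = J (mul x y)"
    and mul_J_left: "x \<in> C \<Longrightarrow> y \<in> C \<Longrightarrow> mul (J x) y = J (mul x y)"
    and st_J: "x \<in> C \<Longrightarrow> st (J x) = - J (st x)"
    and J_J: "x \<in> C \<Longrightarrow> J (J x) = - x"
    and J_minus: "x \<in> C \<Longrightarrow> J (- x) = - J x"
    and J_add: "x \<in> C \<Longrightarrow> y \<in> C \<Longrightarrow> J (x + y) = J x + J y"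
    and op_linear: "x \<in> C \<Longrightarrow> linear (op x)"
    and op_add: "x \<in> C \<Longrightarrow> y \<in> C \<Longrightarrow> op (x + y) \<xi> = op x \<xi> + op y \<xi>"
    and op_scaleR: "x \<in> C \<Longrightarrow> op (r *\<^sub>R x) \<xi> = r *\<^sub>R op x \<xi>"
    and op_mul: "x \<in> C \<Longrightarrow> y \<in> C \<Longrightarrow> op (mul x y) \<xi> = op x (op y \<xi>)"
    and op_st: "x \<in> C \<Longrightarrow> inner (op (st x) \<xi>) \<eta> = inner \<xi> (op x \<eta>)"
    and norm_op_J: "x \<in> C \<Longrightarrow> norm (op (J x) \<xi>) = norm (op x \<xi>)"
begin

lemma neg_in: "x \<in> C \<Longrightarrow> - x \<in> C"
  using subspace_scale[OF sub, of x "-1"] by simp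

lemmas closed = subspace_add[OF sub] subspace_diff[OF sub] subspace_scale[OF sub] neg_in
  mul_in st_in J_in

lemma op_minus: "x \<in> C \<Longrightarrow> op (- x) \<xi> = - op x \<xi>"
  using op_scaleR[of x "-1" \<xi>] by simp

lemma op_diff: "x \<in> C \<Longrightarrow> y \<in> C \<Longrightarrow> op (x - y) \<xi> = op x \<xi> - op y \<xi>"
  using op_add[of x "- y" \<xi>] by (simp add: op_minus closed)

text \<open>\<open>var1\<close> and \<open>var2\<close> are the first and second Taylor coefficients
  of the Moebius curve through \<open>x\<close> in direction \<open>a\<close>.\<close>

definition var1 :: "'c \<Rightarrow> 'c \<Rightarrow> 'c" where
  "var1 x a = a - mul x (mul (st a) x)"

definition var2 :: "'c \<Rightarrow> 'c \<Rightarrow> 'c" where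
  "var2 x a = mul x (mul (st a) (mul x (mul (st a) x)))
     - (1/2) *\<^sub>R (mul a (mul (st a) x) + mul x (mul (st a) a))"

lemma var_in: "x \<in> C \<Longrightarrow> a \<in> C \<Longrightarrow> var1 x a \<in> C" "x \<in> C \<Longrightarrow> a \<in> C \<Longrightarrow> var2 x a \<in> C"
  unfolding var1_def var2_def by (auto intro!: closed)

lemma norm_op_variation:
  assumes x: "x \<in> C" "\<And>\<xi>. norm (op x \<xi>) \<le> norm \<xi>"
    and a: "a \<in> C" "\<And>\<xi>. norm (op a \<xi>) \<le> \<kappa> * norm \<xi>"
    and s: "0 \<le> \<kappa>" "\<bar>s\<bar> * \<kappa> \<le> 1"
  shows "(norm (op (x + s *\<^sub>R var1 x a + s\<^sup>2 *\<^sub>R var2 x a) \<eta>))\<^sup>2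
    \<le> (1 + 50 * (\<bar>s\<bar> * \<kappa>) ^ 3) * (norm \<eta>)\<^sup>2"
proof -
  define b bs where "b = (\<lambda>\<xi>. s *\<^sub>R op a \<xi>)" and "bs = (\<lambda>\<xi>. s *\<^sub>R op (st a) \<xi>)"
  have lin: "linear b" "linear bs"
    unfolding b_def bs_def using op_linear[OF a(1)] op_linear[OF st_in[OF a(1)]]
    by (auto intro!: linear_compose_scale_right)
  have nb: "norm (b \<xi>) \<le> (\<bar>s\<bar> * \<kappa>) * norm \<xi>" for \<xi>
    using mult_left_mono[OF a(2)[of \<xi>], of "\<bar>s\<bar>"] by (simp add: b_def mult_ac)
  note l = linear_scale[OF op_linear]
  have "op (x + s *\<^sub>R var1 x a + s\<^sup>2 *\<^sub>R var2 x a) \<eta> =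
    op x \<eta> + (b \<eta> - op x (bs (op x \<eta>))) + (op x (bs (op x (bs (op x \<eta>))))
      - (1/2) *\<^sub>R (b (bs (op x \<eta>)) + op x (bs (b \<eta>))))"
    unfolding var1_def var2_def b_def bs_def using x(1) a(1)
    by (simp add: closed op_add op_diff op_scaleR op_mul l algebra_simps power2_eq_square)
  then show ?thesis
    using moebius_contraction[OF op_linear[OF x(1)] lin _ x(2) nb, of \<eta>] s
    by (simp add: b_def bs_def op_st[OF a(1)] add.assoc)
qed

text \<open>
  Averaging over \<open>\<plusminus>s\<close> removes the first-order terms; adding the inequalities for \<open>a\<close> and \<open>J a\<close>
  cancels the term \<open>x a* x a* x\<close> of \<open>var2\<close> and the mixed terms of \<open>\<parallel>v (var1 x a)\<parallel>\<^sup>2\<close>.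
\<close>

lemma norm_variation_le:
  fixes v :: "'c \<Rightarrow> 'w::real_inner"
  assumes v_add: "\<And>x y. x \<in> C \<Longrightarrow> y \<in> C \<Longrightarrow> v (x + y) = v x + v y"
    and v_scale: "\<And>r x. x \<in> C \<Longrightarrow> v (r *\<^sub>R x) = r *\<^sub>R v x"
    and v_J: "\<And>x. x \<in> C \<Longrightarrow> norm (v (J x)) = norm (v x)"
    and v_bd: "\<And>x K. x \<in> C \<Longrightarrow> 0 < K \<Longrightarrow> (\<And>\<xi>. (norm (op x \<xi>))\<^sup>2 \<le> K * (norm \<xi>)\<^sup>2) \<Longrightarrow> (norm (v x))\<^sup>2 \<le> q * K"
    and x: "x \<in> C" "\<And>\<xi>. norm (op x \<xi>) \<le> norm \<xi>" "q - \<epsilon> \<le> (norm (v x))\<^sup>2"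
    and a: "a \<in> C" "\<And>\<xi>. norm (op a \<xi>) \<le> \<kappa> * norm \<xi>"
    and s: "0 \<le> \<kappa>" "0 < s" "s * \<kappa> \<le> 1"
  shows "s\<^sup>2 * (norm (v a))\<^sup>2 \<le> s\<^sup>2 * inner (v x) (v (mul a (mul (st a) x) + mul x (mul (st a) a)))
     + \<epsilon> + q * (50 * (s * \<kappa>) ^ 3)"
proof -
  have v_minus: "v (- y) = - v y" if "y \<in> C" for y
    using v_scale[OF that, of "-1"] by simp
  have v_diff: "v (y - z) = v y - v z" if "y \<in> C" "z \<in> C" for y z
    using v_add[of y "- z"] that by (simp add: v_minus closed)
  define c where "c = 50 * (s * \<kappa>) ^ 3"
  have c: "0 \<le> c" using s by (simp add: c_def)
  have key: "(norm (v x))\<^sup>2 + 2 * (s\<^sup>2 * inner (v x) (v (var2 x b))) + s\<^sup>2 * (norm (v (var1 x b)))\<^sup>2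
     \<le> q * (1 + c)" if b: "b \<in> C" "\<And>\<xi>. norm (op b \<xi>) \<le> \<kappa> * norm \<xi>" for b
  proof -
    have le: "(norm (v x + t *\<^sub>R v (var1 x b) + t\<^sup>2 *\<^sub>R v (var2 x b)))\<^sup>2 \<le> q * (1 + c)" if "\<bar>t\<bar> = s" for t
    proof -
      have "(norm (v (x + t *\<^sub>R var1 x b + t\<^sup>2 *\<^sub>R var2 x b)))\<^sup>2 \<le> q * (1 + c)"
      proof (rule v_bd)
        show "x + t *\<^sub>R var1 x b + t\<^sup>2 *\<^sub>R var2 x b \<in> C"
          using x(1) b(1) by (simp add: closed var_in)
        show "0 < 1 + c"
          using c by linarith
        show "(norm (op (x + t *\<^sub>R var1 x b + t\<^sup>2 *\<^sub>R var2 x b) \<xi>))\<^sup>2 \<le> (1 + c) * (norm \<xi>)\<^sup>2" for \<xi>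
          using norm_op_variation[OF x(1,2) b s(1), of t \<xi>] s that by (simp add: c_def)
      qed
      then show ?thesis
        using x(1) b(1) by (simp add: v_add v_scale closed var_in)
    qed
    have "(norm (v x + s *\<^sub>R v (var1 x b) + s\<^sup>2 *\<^sub>R v (var2 x b)))\<^sup>2
        + (norm (v x + (- s) *\<^sub>R v (var1 x b) + (- s)\<^sup>2 *\<^sub>R v (var2 x b)))\<^sup>2
        = 2 * (norm (v x))\<^sup>2 + 4 * (s\<^sup>2 * inner (v x) (v (var2 x b)))
          + 2 * (s\<^sup>2 * (norm (v (var1 x b)))\<^sup>2) + 2 * ((s\<^sup>2)\<^sup>2 * (norm (v (var2 x b)))\<^sup>2)"
      unfolding power2_norm_eq_inner
      by (simp add: inner_add_left inner_add_right algebra_simps power2_eq_square inner_commute)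
    moreover have "0 \<le> (s\<^sup>2)\<^sup>2 * (norm (v (var2 x b)))\<^sup>2"
      by simp
    ultimately show ?thesis
      using le[of s] le[of "- s"] s(2) by linarith
  qed
  define w where "w = mul x (mul (st a) x)"
  define T where "T = mul a (mul (st a) x) + mul x (mul (st a) a)"
  have in_C: "w \<in> C" "T \<in> C"
    using x(1) a(1) by (auto simp: w_def T_def intro!: closed)
  \<comment> \<open>\<open>st\<close> is conjugate-linear, so the term with \<open>st a\<close>
    changes sign relative to \<open>a\<close>; the parallelogram law then removes the mixed
    terms.\<close>
  have "var1 x (J a) = J (a + w)"
    using x(1) a(1)
    by (simp add: var1_def w_def st_J J_add mul_minus_left mul_minus_right mul_J_left mul_J_right closed)
  then have "(norm (v (var1 x (J a))))\<^sup>2 = (norm (v a + v w))\<^sup>2"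
    using in_C a(1) by (simp add: v_J v_add closed)
  moreover have "(norm (v (var1 x a)))\<^sup>2 = (norm (v a - v w))\<^sup>2"
    using in_C a(1) by (simp add: var1_def v_diff flip: w_def)
  moreover have "(norm (v a - v w))\<^sup>2 + (norm (v a + v w))\<^sup>2 = 2 * (norm (v a))\<^sup>2 + 2 * (norm (v w))\<^sup>2"
    unfolding power2_norm_eq_inner by (simp add: algebra_simps inner_add_left inner_add_right)
  ultimately have *: "2 * (norm (v a))\<^sup>2 \<le> (norm (v (var1 x a)))\<^sup>2 + (norm (v (var1 x (J a))))\<^sup>2"
    by simp
  define m h where "m = mul x (mul (st a) (mul x (mul (st a) x)))" and "h = (1/2) *\<^sub>R T"
  \<comment> \<open>\<open>m\<close> contains \<open>st a\<close> twice and changes sign.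
    \<open>h\<close> pairs one \<open>a\<close> with one \<open>st a\<close>, so the imaginary units
    cancel and it is kept.\<close>
  have "var2 x (J a) = - m - h"
    using x(1) a(1)
    by (simp add: var2_def m_def h_def T_def st_J J_J J_minus mul_minus_left mul_minus_right
        mul_J_left mul_J_right closed)
  moreover have "var2 x a = m - h"
    by (simp add: var2_def m_def h_def T_def)
  moreover have "T = h + h"
    by (simp add: h_def flip: scaleR_add_left)
  ultimately have "var2 x a + var2 x (J a) = - T"
    by simp
  then have "v (var2 x a) + v (var2 x (J a)) = - v T"
    by (metis J_in a(1) in_C(2) v_add v_minus var_in(2) x(1))
  then have **: "inner (v x) (v (var2 x a)) + inner (v x) (v (var2 x (J a))) = - inner (v x) (v T)"
    by (metis inner_add_right inner_minus_right)
  have "2 * (norm (v x))\<^sup>2 + 2 * (s\<^sup>2 * (inner (v x) (v (var2 x a)) + inner (v x) (v (var2 x (J a)))))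
     + s\<^sup>2 * ((norm (v (var1 x a)))\<^sup>2 + (norm (v (var1 x (J a))))\<^sup>2) \<le> 2 * (q * (1 + c))"
    using key[OF a] key[of "J a"] a by (simp add: norm_op_J J_in distrib_left)
  moreover have "s\<^sup>2 * (2 * (norm (v a))\<^sup>2) \<le> s\<^sup>2 * ((norm (v (var1 x a)))\<^sup>2 + (norm (v (var1 x (J a))))\<^sup>2)"
    using * by (intro mult_left_mono) auto
  ultimately have "2 * (norm (v x))\<^sup>2 + s\<^sup>2 * (2 * (norm (v a))\<^sup>2) - 2 * (s\<^sup>2 * inner (v x) (v T)) \<le> 2 * (q * (1 + c))"
    unfolding ** by simp
  then show ?thesis
    using x(3) unfolding T_def[symmetric] c_def[symmetric] by (simp add: distrib_left)
qed

text \<open>A bound on a positive quadratic form bounds its operator: pair the image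
  \<open>?w\<close> of \<open>\<xi>\<close> with itself, apply Cauchy-Schwarz over \<open>A\<close>,
  and use the form bound at both \<open>\<xi>\<close> and \<open>?w\<close>.\<close>

lemma norm_sum_adjoint_le:
  assumes A: "finite A" "\<And>i. i \<in> A \<Longrightarrow> a i \<in> C" and K: "0 \<le> K"
    and bd: "\<And>\<xi>. (\<Sum>i\<in>A. (norm (op (a i) \<xi>))\<^sup>2) \<le> K * (norm \<xi>)\<^sup>2"
  shows "norm (\<Sum>i\<in>A. op (st (a i)) (op (a i) \<xi>)) \<le> K * norm \<xi>" (is "norm ?w \<le> _")
proof -
  have "(norm ?w)\<^sup>2 = (\<Sum>i\<in>A. inner (op (a i) \<xi>) (op (a i) ?w))"
    using A by (simp add: power2_norm_eq_inner inner_sum_left op_st)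
  also have "\<dots> \<le> (\<Sum>i\<in>A. norm (op (a i) \<xi>) * norm (op (a i) ?w))"
    by (intro sum_mono norm_cauchy_schwarz)
  also have "\<dots> \<le> L2_set (\<lambda>i. norm (op (a i) \<xi>)) A * L2_set (\<lambda>i. norm (op (a i) ?w)) A"
    using L2_set_mult_ineq[of "\<lambda>i. norm (op (a i) \<xi>)" "\<lambda>i. norm (op (a i) ?w)" A] by simp
  also have "\<dots> \<le> sqrt (K * (norm \<xi>)\<^sup>2) * sqrt (K * (norm ?w)\<^sup>2)"
    unfolding L2_set_def by (intro mult_mono real_sqrt_le_mono bd) (use K in \<open>auto intro!: sum_nonneg\<close>)
  also have "\<dots> = K * norm \<xi> * norm ?w"
    using K by (simp add: real_sqrt_mult)
  finally have "norm ?w * norm ?w \<le> K * norm \<xi> * norm ?w"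
    by (simp add: power2_eq_square)
  then show ?thesis
    using K by (cases "norm ?w = 0") (auto simp: mult_le_cancel_right)
qed

text \<open>A maximiser in the unit ball need not exist, so \<open>x\<close> is chosen for each step
  \<open>s\<close> with defect below \<open>s ^ 3\<close> from the supremum \<open>q\<close>. After
  division by the square of \<open>s\<close>, this defect and the cubic Moebius error are both of
  order \<open>s\<close>.\<close>

theorem little_grothendieck:
  fixes v :: "'c \<Rightarrow> 'w::real_inner"
  assumes v_add: "\<And>x y. x \<in> C \<Longrightarrow> y \<in> C \<Longrightarrow> v (x + y) = v x + v y"
    and v_scale: "\<And>r x. x \<in> C \<Longrightarrow> v (r *\<^sub>R x) = r *\<^sub>R v x"
    and v_J: "\<And>x. x \<in> C \<Longrightarrow> norm (v (J x)) = norm (v x)"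
    and v_bd: "\<And>x. x \<in> C \<Longrightarrow> (\<And>\<xi>. norm (op x \<xi>) \<le> norm \<xi>) \<Longrightarrow> norm (v x) \<le> \<beta>"
    and A: "finite A" "\<And>i. i \<in> A \<Longrightarrow> a i \<in> C" and K: "0 < K" "0 < L"
    and bd: "\<And>\<xi>. (\<Sum>i\<in>A. (norm (op (a i) \<xi>))\<^sup>2) \<le> K * (norm \<xi>)\<^sup>2"
    and bd': "\<And>\<xi>. (\<Sum>i\<in>A. (norm (op (st (a i)) \<xi>))\<^sup>2) \<le> L * (norm \<xi>)\<^sup>2"
  shows "(\<Sum>i\<in>A. (norm (v (a i)))\<^sup>2) \<le> \<beta>\<^sup>2 * (K + L)"
proof -
  define U where "U = {x \<in> C. \<forall>\<xi>. norm (op x \<xi>) \<le> norm \<xi>}"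
  define q where "q = Sup ((\<lambda>x. (norm (v x))\<^sup>2) ` U)"
  have v0: "v 0 = 0"
    using v_scale[of 0 0] subspace_0[OF sub] by simp
  have op0: "op 0 \<xi> = 0" for \<xi>
    using op_scaleR[of 0 0 \<xi>] subspace_0[OF sub] by simp
  have "0 \<in> U"
    by (auto simp: U_def op0 subspace_0[OF sub])
  have U_bd: "(norm (v x))\<^sup>2 \<le> \<beta>\<^sup>2" if "x \<in> U" for x
    using v_bd[of x] that by (intro power_mono) (auto simp: U_def)
  then have bdd: "bdd_above ((\<lambda>x. (norm (v x))\<^sup>2) ` U)"
    by (auto intro!: bdd_aboveI)
  have "q \<le> \<beta>\<^sup>2"
    unfolding q_def by (rule cSUP_least) (use \<open>0 \<in> U\<close> U_bd in auto)
  moreover have "0 \<le> q"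
    using cSUP_upper[OF \<open>0 \<in> U\<close> bdd] by (simp add: q_def v0)
  ultimately have q: "q \<le> \<beta>\<^sup>2" "0 \<le> q" .
  have v_q: "(norm (v x))\<^sup>2 \<le> q * k" if x: "x \<in> C" "0 < k" "\<And>\<xi>. (norm (op x \<xi>))\<^sup>2 \<le> k * (norm \<xi>)\<^sup>2" for x k
  proof -
    have "norm (op ((1 / sqrt k) *\<^sub>R x) \<xi>) \<le> norm \<xi>" for \<xi>
    proof (rule power2_le_imp_le)
      show "(norm (op ((1 / sqrt k) *\<^sub>R x) \<xi>))\<^sup>2 \<le> (norm \<xi>)\<^sup>2"
        using x(1,2) x(3)[of \<xi>] by (simp add: op_scaleR power_divide divide_simps mult_ac)
    qed simp
    then have "(1 / sqrt k) *\<^sub>R x \<in> U"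
      using x(1) by (auto simp: U_def closed)
    then have "(norm (v ((1 / sqrt k) *\<^sub>R x)))\<^sup>2 \<le> q"
      unfolding q_def using bdd by (rule cSUP_upper)
    then show ?thesis
      using x(1,2) by (simp add: v_scale power_divide divide_simps)
  qed
  define \<kappa> where "\<kappa> = sqrt K"
  have a_bd: "norm (op (a i) \<xi>) \<le> \<kappa> * norm \<xi>" if "i \<in> A" for i \<xi>
  proof (rule power2_le_imp_le)
    have "(norm (op (a i) \<xi>))\<^sup>2 \<le> (\<Sum>i\<in>A. (norm (op (a i) \<xi>))\<^sup>2)"
      using A(1) that by (auto intro: member_le_sum)
    then show "(norm (op (a i) \<xi>))\<^sup>2 \<le> (\<kappa> * norm \<xi>)\<^sup>2"
      using bd[of \<xi>] K by (simp add: power_mult_distrib \<kappa>_def)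
  qed (use K in \<open>auto simp: \<kappa>_def\<close>)
  have \<kappa>: "0 < \<kappa>" using K by (simp add: \<kappa>_def)
  define M where "M = real (card A) * (1 + q * (50 * \<kappa> ^ 3))"
  have main: "(\<Sum>i\<in>A. (norm (v (a i)))\<^sup>2) \<le> q * (K + L) + s * M" if s: "0 < s" "s * \<kappa> \<le> 1" for s
  proof -
    have "q - s ^ 3 < q" using s by simp
    then obtain x where "x \<in> U" "q - s ^ 3 < (norm (v x))\<^sup>2"
      using less_cSUP_iff[OF _ bdd] \<open>0 \<in> U\<close> unfolding q_def by blast
    then have x: "x \<in> C" "\<And>\<xi>. norm (op x \<xi>) \<le> norm \<xi>" "q - s ^ 3 \<le> (norm (v x))\<^sup>2"
      by (auto simp: U_def)
    define T where "T i = mul (a i) (mul (st (a i)) x) + mul x (mul (st (a i)) (a i))" for i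
    have T: "T i \<in> C" if "i \<in> A" for i
      using x A(2)[OF that] by (auto simp: T_def intro!: closed)
    have "s\<^sup>2 * (norm (v (a i)))\<^sup>2 \<le> s\<^sup>2 * (inner (v x) (v (T i)) + s * (1 + q * (50 * \<kappa> ^ 3)))" if "i \<in> A" for i
      using norm_variation_le[OF v_add v_scale v_J v_q x A(2)[OF that] a_bd[OF that] less_imp_le[OF \<kappa>] s]
      by (simp add: T_def algebra_simps power2_eq_square power3_eq_cube)
    then have "(norm (v (a i)))\<^sup>2 \<le> inner (v x) (v (T i)) + s * (1 + q * (50 * \<kappa> ^ 3))" if "i \<in> A" for i
      using s(1) that by (meson mult_le_cancel_left_pos zero_less_power)
    then have "(\<Sum>i\<in>A. (norm (v (a i)))\<^sup>2) \<le> (\<Sum>i\<in>A. inner (v x) (v (T i)) + s * (1 + q * (50 * \<kappa> ^ 3)))"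
      by (rule sum_mono)
    also have "\<dots> = inner (v x) (\<Sum>i\<in>A. v (T i)) + s * M"
      by (simp add: sum.distrib inner_sum_right M_def)
    \<comment> \<open>The common \<open>x\<close> pays off here: one application of the bound on
      \<open>v\<close> to the summed element involves \<open>K + L\<close>, not a sum of individual
      norms.\<close>
    also have "(\<Sum>i\<in>A. v (T i)) = v (\<Sum>i\<in>A. T i)"
      using A(1) T
    proof (induction A rule: finite_induct)
      case (insert i A)
      then show ?case
        by (simp add: v_add subspace_sum[OF sub])
    qed (simp add: v0)
    also have "inner (v x) (v (\<Sum>i\<in>A. T i)) \<le> norm (v x) * norm (v (\<Sum>i\<in>A. T i))"
      by (rule norm_cauchy_schwarz)
    also have "\<dots> \<le> sqrt q * (sqrt q * (K + L))"
    proof (intro mult_mono)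
      show "norm (v x) \<le> sqrt q"
        using v_q[of x 1] x by (intro real_le_rsqrt) simp
      have "norm (op (\<Sum>i\<in>A. T i) \<xi>) \<le> (K + L) * norm \<xi>" for \<xi>
      proof -
        have "op (\<Sum>i\<in>A. T i) \<xi> = (\<Sum>i\<in>A. op (T i) \<xi>)"
          using A(1) T
        proof (induction A rule: finite_induct)
          case (insert i A)
          then show ?case
            by (simp add: op_add subspace_sum[OF sub])
        qed (simp add: op0)
        also have "\<dots> = (\<Sum>i\<in>A. op (st (st (a i))) (op (st (a i)) (op x \<xi>))) + op x (\<Sum>i\<in>A. op (st (a i)) (op (a i) \<xi>))"
        proof -
          \<comment> \<open>Both operators have the same adjoint and hence agree. This puts the
            terms \<open>a i (st (a i))\<close> into the form of \<open>norm_sum_adjoint_le\<close>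
            for the family \<open>st (a i)\<close>.\<close>
          have "op (st (st (a i))) \<eta> = op (a i) \<eta>" if "i \<in> A" for i \<eta>
          proof -
            have "inner (op (st (st (a i))) \<eta>) z = inner (op (a i) \<eta>) z" for z
              unfolding op_st[OF st_in[OF A(2)[OF that]]]
              by (subst (1 2) inner_commute) (rule op_st[OF A(2)[OF that]])
            then have "inner (op (st (st (a i))) \<eta> - op (a i) \<eta>) (op (st (st (a i))) \<eta> - op (a i) \<eta>) = 0"
              by (simp add: inner_diff_left)
            then show ?thesis by simp
          qed
          then show ?thesis
            using x(1) A(2) by (simp add: T_def op_add op_mul closed sum.distrib linear_sum[OF op_linear])
        qed
        also have "norm \<dots> \<le> L * norm (op x \<xi>) + norm (\<Sum>i\<in>A. op (st (a i)) (op (a i) \<xi>))"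
          using norm_sum_adjoint_le[OF A(1) st_in[OF A(2)] less_imp_le[OF K(2)] bd'] x
          by (intro norm_triangle_mono) auto
        also have "\<dots> \<le> L * norm \<xi> + K * norm \<xi>"
          using K x(2) norm_sum_adjoint_le[OF A less_imp_le[OF K(1)] bd]
          by (intro add_mono mult_left_mono) auto
        finally show ?thesis by (simp add: algebra_simps)
      qed
      then have "(norm (v (\<Sum>i\<in>A. T i)))\<^sup>2 \<le> q * (K + L)\<^sup>2"
        using K T by (intro v_q) (simp_all add: subspace_sum[OF sub] power_mono flip: power_mult_distrib)
      then show "norm (v (\<Sum>i\<in>A. T i)) \<le> sqrt q * (K + L)"
        using K q by - (rule power2_le_imp_le; simp add: power_mult_distrib)
    qed (use q in auto)
    also have "sqrt q * (sqrt q * (K + L)) = q * (K + L)"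
      using q by simp
    finally show ?thesis by simp
  qed
  have "(\<Sum>i\<in>A. (norm (v (a i)))\<^sup>2) \<le> q * (K + L)"
  proof (rule field_le_epsilon)
    fix e :: real assume "0 < e"
    have M: "0 \<le> M" using q \<kappa> by (simp add: M_def)
    define s where "s = min (1 / \<kappa>) (e / (M + 1))"
    have s: "0 < s" "s \<le> 1 / \<kappa>" "s \<le> e / (M + 1)"
      using \<kappa> M \<open>0 < e\<close> by (auto simp: s_def)
    then have s: "0 < s" "s * \<kappa> \<le> 1" "s * (M + 1) \<le> e"
      using \<kappa> M by (auto simp: pos_le_divide_eq)
    then have "s * M \<le> e"
      by (simp add: algebra_simps)
    then show "(\<Sum>i\<in>A. (norm (v (a i)))\<^sup>2) \<le> q * (K + L) + e"
      using main[OF s(1,2)] by linarith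
  qed
  also have "\<dots> \<le> \<beta>\<^sup>2 * (K + L)"
    using q K by (intro mult_right_mono) auto
  finally show ?thesis .
qed

end

section \<open>Operator matrices\<close>

text \<open>Boundedness by \<open>C\<close> of all finite truncations, so that \<open>I\<close> and \<open>J\<close> may be infinite.\<close>

definition matrix_bound ::
    "'i set \<Rightarrow> 'j set \<Rightarrow> ('i \<Rightarrow> 'j \<Rightarrow> 'h::real_normed_vector \<Rightarrow> 'h) \<Rightarrow> real \<Rightarrow> bool" where
  "matrix_bound I J M C \<longleftrightarrow> (\<forall>F D \<xi>. finite F \<and> F \<subseteq> I \<and> finite D \<and> D \<subseteq> J \<longrightarrow>
     (\<Sum>p\<in>F. (norm (\<Sum>q\<in>D. M p q (\<xi> q)))\<^sup>2) \<le> C\<^sup>2 * (\<Sum>q\<in>D. (norm (\<xi> q))\<^sup>2))"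

lemma matrix_boundD:
  assumes "matrix_bound I J M C" "finite F" "F \<subseteq> I" "finite D" "D \<subseteq> J"
  shows "(\<Sum>p\<in>F. (norm (\<Sum>q\<in>D. M p q (\<xi> q)))\<^sup>2) \<le> C\<^sup>2 * (\<Sum>q\<in>D. (norm (\<xi> q))\<^sup>2)"
  using assms unfolding matrix_bound_def by blast

lemma matrix_bound_reindex:
  assumes bd: "matrix_bound I J M C" and inj: "inj_on f I'" "inj_on g J'"
    and sub: "f ` I' \<subseteq> I" "g ` J' \<subseteq> J"
    and N: "\<And>p q. p \<in> I' \<Longrightarrow> q \<in> J' \<Longrightarrow> N p q = M (f p) (g q)"
  shows "matrix_bound I' J' N C"
  unfolding matrix_bound_def
proof (intro allI impI, elim conjE)
  fix F D \<xi> assume F: "finite F" "F \<subseteq> I'" and D: "finite D" "D \<subseteq> J'"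
  have injF: "inj_on f F" and injD: "inj_on g D"
    using inj F D by (auto intro: inj_on_subset)
  have "(\<Sum>p\<in>f ` F. (norm (\<Sum>q\<in>g ` D. M p q (\<xi> (inv_into D g q))))\<^sup>2)
      \<le> C\<^sup>2 * (\<Sum>q\<in>g ` D. (norm (\<xi> (inv_into D g q)))\<^sup>2)"
    by (rule matrix_boundD[OF bd]) (use F D sub in blast)+
  also have "(\<Sum>q\<in>g ` D. (norm (\<xi> (inv_into D g q)))\<^sup>2) = (\<Sum>q\<in>D. (norm (\<xi> q))\<^sup>2)"
    by (simp add: sum.reindex[OF injD] injD)
  also have "(\<Sum>p\<in>f ` F. (norm (\<Sum>q\<in>g ` D. M p q (\<xi> (inv_into D g q))))\<^sup>2)
      = (\<Sum>p\<in>F. (norm (\<Sum>q\<in>D. N p q (\<xi> q)))\<^sup>2)"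
    unfolding sum.reindex[OF injD] sum.reindex[OF injF] o_def
    by (intro sum.cong arg_cong[where f = "\<lambda>x. (norm x)\<^sup>2"]) (simp_all add: N subsetD[OF F(2)] subsetD[OF D(2)] injD)
  finally show "(\<Sum>p\<in>F. (norm (\<Sum>q\<in>D. N p q (\<xi> q)))\<^sup>2) \<le> C\<^sup>2 * (\<Sum>q\<in>D. (norm (\<xi> q))\<^sup>2)" .
qed

text \<open>Larger truncations are harder: vectors can be padded by zero and extra rows only
  increase the left side. So a cofinal family, such as products of finite sets, is enough to
  check.\<close>

lemma matrix_boundI:
  assumes zero: "\<And>p q. M p q 0 = 0"
    and ex: "\<And>F D. finite F \<Longrightarrow> F \<subseteq> I \<Longrightarrow> finite D \<Longrightarrow> D \<subseteq> J \<Longrightarrow>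
      \<exists>F' D'. finite F' \<and> F \<subseteq> F' \<and> finite D' \<and> D \<subseteq> D' \<and>
        (\<forall>\<xi>. (\<Sum>p\<in>F'. (norm (\<Sum>q\<in>D'. M p q (\<xi> q)))\<^sup>2) \<le> C\<^sup>2 * (\<Sum>q\<in>D'. (norm (\<xi> q))\<^sup>2))"
  shows "matrix_bound I J M C"
  unfolding matrix_bound_def
proof (intro allI impI, elim conjE)
  fix F D and \<xi> :: "'b \<Rightarrow> 'c" assume F: "finite F" "F \<subseteq> I" and D: "finite D" "D \<subseteq> J"
  from ex[OF this] obtain F' D' where F': "finite F'" "F \<subseteq> F'" and D': "finite D'" "D \<subseteq> D'"
    and le: "\<And>\<xi>. (\<Sum>p\<in>F'. (norm (\<Sum>q\<in>D'. M p q (\<xi> q)))\<^sup>2) \<le> C\<^sup>2 * (\<Sum>q\<in>D'. (norm (\<xi> q))\<^sup>2)"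
    by blast
  define \<zeta> where "\<zeta> q = (if q \<in> D then \<xi> q else 0)" for q
  have eq: "(\<Sum>q\<in>D. M p q (\<xi> q)) = (\<Sum>q\<in>D'. M p q (\<zeta> q))" for p
    by (rule sum.mono_neutral_cong_left) (use D' zero in \<open>auto simp: \<zeta>_def\<close>)
  have "(\<Sum>p\<in>F. (norm (\<Sum>q\<in>D. M p q (\<xi> q)))\<^sup>2) \<le> (\<Sum>p\<in>F'. (norm (\<Sum>q\<in>D'. M p q (\<zeta> q)))\<^sup>2)"
    unfolding eq by (rule sum_mono2) (use F' in auto)
  also have "\<dots> \<le> C\<^sup>2 * (\<Sum>q\<in>D'. (norm (\<zeta> q))\<^sup>2)"
    by (rule le)
  also have "(\<Sum>q\<in>D'. (norm (\<zeta> q))\<^sup>2) = (\<Sum>q\<in>D. (norm (\<xi> q))\<^sup>2)"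
    by (rule sum.mono_neutral_cong_right) (use D' in \<open>auto simp: \<zeta>_def\<close>)
  finally show "(\<Sum>p\<in>F. (norm (\<Sum>q\<in>D. M p q (\<xi> q)))\<^sup>2) \<le> C\<^sup>2 * (\<Sum>q\<in>D. (norm (\<xi> q))\<^sup>2)" .
qed

definition col_bound ::
    "nat \<Rightarrow> 'r set \<Rightarrow> 's set \<Rightarrow> (nat \<Rightarrow> 'r \<Rightarrow> 's \<Rightarrow> 'h::real_normed_vector \<Rightarrow> 'h) \<Rightarrow> real \<Rightarrow> bool" where
  "col_bound n I J b C \<longleftrightarrow> matrix_bound ({..<n} \<times> I) J (\<lambda>(i, r) r'. b i r r') C"

definition row_bound ::
    "nat \<Rightarrow> 'r set \<Rightarrow> 's set \<Rightarrow> (nat \<Rightarrow> 'r \<Rightarrow> 's \<Rightarrow> 'h::real_normed_vector \<Rightarrow> 'h) \<Rightarrow> real \<Rightarrow> bool" where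
  "row_bound n I J b C \<longleftrightarrow> matrix_bound I ({..<n} \<times> J) (\<lambda>r (i, r'). b i r r') C"

lemma col_boundD:
  assumes "col_bound n I J b C" "finite F" "F \<subseteq> I" "finite D" "D \<subseteq> J"
  shows "(\<Sum>i<n. \<Sum>r\<in>F. (norm (\<Sum>r'\<in>D. b i r r' (\<xi> r')))\<^sup>2) \<le> C\<^sup>2 * (\<Sum>q\<in>D. (norm (\<xi> q))\<^sup>2)"
  using matrix_boundD[OF assms(1)[unfolded col_bound_def]
      finite_cartesian_product[OF finite_lessThan assms(2)] _ assms(4,5), of n \<xi>] assms(3)
  by (simp add: sum.cartesian_product case_prod_unfold Sigma_mono)

lemma row_boundD:
  assumes "row_bound n I J b C" "finite F" "F \<subseteq> I" "finite D" "D \<subseteq> J"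
  shows "(\<Sum>r\<in>F. (norm (\<Sum>i<n. \<Sum>r'\<in>D. b i r r' (\<xi> i r')))\<^sup>2) \<le> C\<^sup>2 * (\<Sum>i<n. \<Sum>q\<in>D. (norm (\<xi> i q))\<^sup>2)"
  using matrix_boundD[OF assms(1)[unfolded row_bound_def] assms(2,3)
      finite_cartesian_product[OF finite_lessThan assms(4)], of n "\<lambda>(i, r). \<xi> i r"] assms(5)
  by (simp add: sum.cartesian_product case_prod_unfold Sigma_mono)

text \<open>The sum of \<open>K i\<close> tensor \<open>b i\<close>, where the relation
  \<open>K i\<close> stands for a 0/1 matrix. Both the \<open>\<delta>\<close>'s
  (\<open>delta_rel\<close>) and the left translations by generators (\<open>word_rel\<close>) are
  of this kind.\<close>

definition kernel_matrix where
  "kernel_matrix n K b = (\<lambda>(x, r) (x', r') h. \<Sum>i<(n::nat). if K i x x' then b i r r' h else 0)"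

definition delta_rel :: "nat \<Rightarrow> nat + nat \<Rightarrow> nat + nat \<Rightarrow> bool" where
  "delta_rel i x x' \<longleftrightarrow> x = Inl i \<and> x' = Inl 0 \<or> x = Inr 0 \<and> x' = Inr i"

lemma delta_eq: "delta i p q = (if delta_rel i p q then 1 else 0)"
  by (cases p; cases q) (auto simp: delta_def delta_rel_def matrix_unit_def)

text \<open>For reduced words \<open>w\<close> and \<open>w'\<close> this says \<open>w = g\<^sub>i w'\<close>.\<close>

definition word_rel :: "nat \<Rightarrow> nat list \<Rightarrow> nat list \<Rightarrow> bool" where
  "word_rel i w w' \<longleftrightarrow> w = i # w' \<or> w' = i # w"

text \<open>Column and row are submatrices: second index \<open>Inl 0\<close> in the first case,
  first index \<open>Inr 0\<close> in the second.\<close>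

lemma col_row_of_delta:
  assumes "0 < n"
    and bd: "matrix_bound (({..<n} <+> {..<n}) \<times> I) (({..<n} <+> {..<n}) \<times> J) (kernel_matrix n delta_rel b) C"
  shows "col_bound n I J b C" "row_bound n I J b C"
  unfolding col_bound_def row_bound_def
proof -
  show "matrix_bound ({..<n} \<times> I) J (\<lambda>(i, r) r'. b i r r') C"
    by (rule matrix_bound_reindex[OF bd, of "\<lambda>(i, r). (Inl i, r)" _ "\<lambda>r. (Inl 0, r)"])
      (use assms(1) in \<open>auto simp: inj_on_def kernel_matrix_def delta_rel_def fun_eq_iff\<close>)
  show "matrix_bound I ({..<n} \<times> J) (\<lambda>r (i, r'). b i r r') C"
    by (rule matrix_bound_reindex[OF bd, of "\<lambda>r. (Inr 0, r)" _ "\<lambda>(i, r). (Inr i, r)"])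
      (use assms(1) in \<open>auto simp: inj_on_def kernel_matrix_def delta_rel_def fun_eq_iff\<close>)
qed

text \<open>The column block and the row block have orthogonal domains and orthogonal ranges, so
  their squares add up and no constant is lost.\<close>

lemma delta_of_col_row:
  assumes zero: "\<And>i r r'. b i r r' 0 = 0" and "0 < n"
    and col: "col_bound n I J b C" and row: "row_bound n I J b C"
  shows "matrix_bound (({..<n} <+> {..<n}) \<times> I) (({..<n} <+> {..<n}) \<times> J) (kernel_matrix n delta_rel b) C"
    (is "matrix_bound (?E \<times> _) _ _ _")
proof (rule matrix_boundI)
  fix F :: "((nat + nat) \<times> 'a) set" and D :: "((nat + nat) \<times> 'b) set"
  assume F: "finite F" "F \<subseteq> ?E \<times> I" and D: "finite D" "D \<subseteq> ?E \<times> J"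
  define F2 D2 where "F2 = snd ` F" and "D2 = snd ` D"
  have fin: "finite F2" "finite D2" "F2 \<subseteq> I" "D2 \<subseteq> J"
    using F D by (auto simp: F2_def D2_def)
  have "(\<Sum>p\<in>?E \<times> F2. (norm (\<Sum>q\<in>?E \<times> D2. kernel_matrix n delta_rel b p q (\<xi> q)))\<^sup>2)
      \<le> C\<^sup>2 * (\<Sum>q\<in>?E \<times> D2. (norm (\<xi> q))\<^sup>2)" for \<xi>
  proof -
    have S: "(\<Sum>q\<in>?E \<times> D2. kernel_matrix n delta_rel b p q (\<xi> q)) =
      (\<Sum>j<n. \<Sum>r'\<in>D2. kernel_matrix n delta_rel b p (Inl j, r') (\<xi> (Inl j, r')))
      + (\<Sum>j<n. \<Sum>r'\<in>D2. kernel_matrix n delta_rel b p (Inr j, r') (\<xi> (Inr j, r')))" for p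
      by (simp add: sum.Plus sum.cartesian_product')
    have l: "(\<Sum>q\<in>?E \<times> D2. kernel_matrix n delta_rel b (Inl i, r) q (\<xi> q))
        = (\<Sum>r'\<in>D2. b i r r' (\<xi> (Inl 0, r')))" if "i < n" for i r
    proof -
      have "(\<Sum>r'\<in>D2. kernel_matrix n delta_rel b (Inl i, r) (Inl j, r') (\<xi> (Inl j, r')))
          = (if j = 0 then \<Sum>r'\<in>D2. b i r r' (\<xi> (Inl 0, r')) else 0)" for j
        using that by (auto simp: kernel_matrix_def delta_rel_def)
      then show ?thesis
        unfolding S using \<open>0 < n\<close> by (simp add: kernel_matrix_def delta_rel_def)
    qed
    have r: "(\<Sum>q\<in>?E \<times> D2. kernel_matrix n delta_rel b (Inr i, r) q (\<xi> q))
        = (if i = 0 then \<Sum>j<n. \<Sum>r'\<in>D2. b j r r' (\<xi> (Inr j, r')) else 0)" for i r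
      unfolding S by (auto simp: kernel_matrix_def delta_rel_def intro!: sum.cong)
    have "(\<Sum>p\<in>?E \<times> F2. (norm (\<Sum>q\<in>?E \<times> D2. kernel_matrix n delta_rel b p q (\<xi> q)))\<^sup>2)
       = (\<Sum>i<n. \<Sum>r\<in>F2. (norm (\<Sum>q\<in>?E \<times> D2. kernel_matrix n delta_rel b (Inl i, r) q (\<xi> q)))\<^sup>2)
       + (\<Sum>i<n. \<Sum>r\<in>F2. (norm (\<Sum>q\<in>?E \<times> D2. kernel_matrix n delta_rel b (Inr i, r) q (\<xi> q)))\<^sup>2)"
      by (subst sum.cartesian_product') (simp only: sum.Plus finite_lessThan o_def)
    also have "\<dots> = (\<Sum>i<n. \<Sum>r\<in>F2. (norm (\<Sum>r'\<in>D2. b i r r' (\<xi> (Inl 0, r'))))\<^sup>2)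
       + (\<Sum>i<n. \<Sum>r\<in>F2. if i = 0 then (norm (\<Sum>j<n. \<Sum>r'\<in>D2. b j r r' (\<xi> (Inr j, r'))))\<^sup>2 else 0)"
      by (intro arg_cong2[where f = "(+)"] sum.cong refl) (simp_all only: l r lessThan_iff if_distrib, simp)
    also have "(\<Sum>i<n. \<Sum>r\<in>F2. if i = 0 then (norm (\<Sum>j<n. \<Sum>r'\<in>D2. b j r r' (\<xi> (Inr j, r'))))\<^sup>2 else 0)
       = (\<Sum>i<n. if i = 0 then \<Sum>r\<in>F2. (norm (\<Sum>j<n. \<Sum>r'\<in>D2. b j r r' (\<xi> (Inr j, r'))))\<^sup>2 else 0)"
      by (intro sum.cong) auto
    also have "\<dots> = (\<Sum>r\<in>F2. (norm (\<Sum>j<n. \<Sum>r'\<in>D2. b j r r' (\<xi> (Inr j, r'))))\<^sup>2)"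
      using \<open>0 < n\<close> by simp
    also have "\<dots> \<le> C\<^sup>2 * (\<Sum>j<n. \<Sum>q\<in>D2. (norm (\<xi> (Inr j, q)))\<^sup>2)"
      by (rule row_boundD[OF row]) (use fin in auto)
    also have "(\<Sum>i<n. \<Sum>r\<in>F2. (norm (\<Sum>r'\<in>D2. b i r r' (\<xi> (Inl 0, r'))))\<^sup>2)
        \<le> C\<^sup>2 * (\<Sum>q\<in>D2. (norm (\<xi> (Inl 0, q)))\<^sup>2)"
      by (rule col_boundD[OF col]) (use fin in auto)
    also have "\<dots> \<le> C\<^sup>2 * (\<Sum>j<n. \<Sum>q\<in>D2. (norm (\<xi> (Inl j, q)))\<^sup>2)"
      by (intro mult_left_mono member_le_sum) (use \<open>0 < n\<close> in \<open>auto intro!: sum_nonneg\<close>)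
    finally show ?thesis
      unfolding sum.cartesian_product' sum.Plus[OF finite_lessThan finite_lessThan] o_def
      by (simp add: distrib_left)
  qed
  moreover have "F \<subseteq> ?E \<times> F2" "D \<subseteq> ?E \<times> D2"
    using F D by (force simp: F2_def D2_def)+
  moreover have "finite (?E \<times> F2)" "finite (?E \<times> D2)"
    using fin by auto
  ultimately show "\<exists>F' D'. finite F' \<and> F \<subseteq> F' \<and> finite D' \<and> D \<subseteq> D' \<and>
      (\<forall>\<xi>. (\<Sum>p\<in>F'. (norm (\<Sum>q\<in>D'. kernel_matrix n delta_rel b p q (\<xi> q)))\<^sup>2)
         \<le> C\<^sup>2 * (\<Sum>q\<in>D'. (norm (\<xi> q))\<^sup>2))"
    by blast
qed (auto simp: kernel_matrix_def zero split_beta intro!: sum.neutral)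

lemma norm_add_power2_le: "(norm (x + y))\<^sup>2 \<le> 2 * (norm x)\<^sup>2 + 2 * (norm (y::'a::real_normed_vector))\<^sup>2"
proof -
  have "(norm (x + y))\<^sup>2 \<le> (norm x + norm y)\<^sup>2"
    by (intro power_mono norm_triangle_ineq) auto
  also have "\<dots> \<le> 2 * (norm x)\<^sup>2 + 2 * (norm y)\<^sup>2"
    using sum_squares_bound[of "norm x" "norm y"] by (simp add: power2_sum)
  finally show ?thesis .
qed

text \<open>
  \<open>\<lambda>(g\<^sub>i)\<close> splits into a part producing words that start with \<open>i\<close> and a part acting on words that
  start with \<open>i\<close>; summed over \<open>i\<close>, the first behaves like a column and the second like a row.
\<close>

lemma word_of_col_row:
  assumes zero: "\<And>i r r'. b i r r' 0 = 0"
    and col: "col_bound n I J b C" and row: "row_bound n I J b C"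
  shows "matrix_bound (UNIV \<times> I) (UNIV \<times> J) (kernel_matrix n word_rel b) (2 * C)"
proof (rule matrix_boundI)
  fix F :: "(nat list \<times> 'a) set" and D :: "(nat list \<times> 'b) set"
  assume F: "finite F" "F \<subseteq> UNIV \<times> I" and D: "finite D" "D \<subseteq> UNIV \<times> J"
  define F1 D1 F2 D2 where "F1 = fst ` F" and "D1 = fst ` D" and "F2 = snd ` F" and "D2 = snd ` D"
  have fin: "finite F1" "finite D1" "finite F2" "finite D2" "F2 \<subseteq> I" "D2 \<subseteq> J"
    using F D by (auto simp: F1_def F2_def D1_def D2_def)
  have "(\<Sum>p\<in>F1 \<times> F2. (norm (\<Sum>q\<in>D1 \<times> D2. kernel_matrix n word_rel b p q (\<xi> q)))\<^sup>2)
      \<le> (2 * C)\<^sup>2 * (\<Sum>q\<in>D1 \<times> D2. (norm (\<xi> q))\<^sup>2)" for \<xi>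
  proof -
    define \<beta> where "\<beta> i r v = (\<Sum>r'\<in>D2. b i r r' (\<xi> (v, r')))" for i r v
    define T1 where "T1 w r = (\<Sum>v\<in>D1. \<Sum>i<n. if w = i # v then \<beta> i r v else 0)" for w r
    define T2 where "T2 w r = (\<Sum>i<n. if i # w \<in> D1 then \<beta> i r (i # w) else 0)" for w r
    have S: "(\<Sum>q\<in>D1 \<times> D2. kernel_matrix n word_rel b (w, r) q (\<xi> q)) = T1 w r + T2 w r" for w r
    proof -
      have "(\<Sum>q\<in>D1 \<times> D2. kernel_matrix n word_rel b (w, r) q (\<xi> q))
          = (\<Sum>v\<in>D1. \<Sum>r'\<in>D2. \<Sum>i<n. if word_rel i w v then b i r r' (\<xi> (v, r')) else 0)"
        by (simp add: kernel_matrix_def sum.cartesian_product')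
      also have "\<dots> = (\<Sum>v\<in>D1. \<Sum>i<n. \<Sum>r'\<in>D2. if word_rel i w v then b i r r' (\<xi> (v, r')) else 0)"
        by (intro sum.cong refl sum.swap)
      also have "\<dots> = (\<Sum>v\<in>D1. \<Sum>i<n. (if w = i # v then \<beta> i r v else 0) + (if v = i # w then \<beta> i r v else 0))"
        by (intro sum.cong refl) (auto simp: word_rel_def \<beta>_def)
      also have "\<dots> = T1 w r + (\<Sum>v\<in>D1. \<Sum>i<n. if v = i # w then \<beta> i r v else 0)"
        by (simp add: sum.distrib T1_def)
      also have "(\<Sum>v\<in>D1. \<Sum>i<n. if v = i # w then \<beta> i r v else 0) = T2 w r"
        unfolding T2_def by (subst sum.swap) (use fin in \<open>simp add: sum.delta\<close>)
      finally show ?thesis .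
    qed
    have col': "(\<Sum>i<n. \<Sum>r\<in>F2. (norm (\<beta> i r v))\<^sup>2) \<le> C\<^sup>2 * (\<Sum>r'\<in>D2. (norm (\<xi> (v, r')))\<^sup>2)" for v
      unfolding \<beta>_def by (rule col_boundD[OF col]) (use fin in auto)
    \<comment> \<open>A word determines its first letter and its tail, so at most one summand of
      \<open>T1 w r\<close> is nonzero.\<close>
    have T1: "(norm (T1 w r))\<^sup>2 = (\<Sum>v\<in>D1. \<Sum>i<n. if w = i # v then (norm (\<beta> i r v))\<^sup>2 else 0)" for w r
    proof (cases w)
      case (Cons i v)
      have "T1 w r = (\<Sum>v'\<in>D1. \<Sum>i'<n. if i' = i then if v' = v then \<beta> i r v else 0 else 0)"
        unfolding T1_def Cons by (intro sum.cong) auto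
      moreover have "(\<Sum>v\<in>D1. \<Sum>i<n. if w = i # v then (norm (\<beta> i r v))\<^sup>2 else 0)
         = (\<Sum>v'\<in>D1. \<Sum>i'<n. if i' = i then if v' = v then (norm (\<beta> i r v))\<^sup>2 else 0 else 0)"
        unfolding Cons by (intro sum.cong) auto
      ultimately show ?thesis
        using fin by (cases "i < n"; cases "v \<in> D1") auto
    qed (simp add: T1_def)
    have "(\<Sum>w\<in>F1. \<Sum>r\<in>F2. (norm (T1 w r))\<^sup>2)
        = (\<Sum>v\<in>D1. \<Sum>i<n. \<Sum>r\<in>F2. \<Sum>w\<in>F1. if w = i # v then (norm (\<beta> i r v))\<^sup>2 else 0)"
      unfolding T1
      by (subst sum.swap, subst (2) sum.swap, subst sum.swap, rule sum.cong, simp,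
          subst (2) sum.swap, subst sum.swap, rule sum.cong, simp, simp)
    also have "\<dots> \<le> (\<Sum>v\<in>D1. \<Sum>i<n. \<Sum>r\<in>F2. (norm (\<beta> i r v))\<^sup>2)"
      using fin by (intro sum_mono) (auto simp: sum.delta)
    also have "\<dots> \<le> (\<Sum>v\<in>D1. C\<^sup>2 * (\<Sum>r'\<in>D2. (norm (\<xi> (v, r')))\<^sup>2))"
      by (intro sum_mono col')
    finally have le1: "(\<Sum>w\<in>F1. \<Sum>r\<in>F2. (norm (T1 w r))\<^sup>2) \<le> C\<^sup>2 * (\<Sum>v\<in>D1. \<Sum>r'\<in>D2. (norm (\<xi> (v, r')))\<^sup>2)"
      by (simp add: sum_distrib_left)
    define N where "N v = (\<Sum>r'\<in>D2. (norm (\<xi> (v, r')))\<^sup>2)" for v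
    have "(\<Sum>r\<in>F2. (norm (T2 w r))\<^sup>2) \<le> C\<^sup>2 * (\<Sum>i<n. if i # w \<in> D1 then N (i # w) else 0)" for w
    proof -
      define \<zeta> where "\<zeta> i r' = (if i # w \<in> D1 then \<xi> (i # w, r') else 0)" for i r'
      have "T2 w r = (\<Sum>i<n. \<Sum>r'\<in>D2. b i r r' (\<zeta> i r'))" for r
        unfolding T2_def \<beta>_def \<zeta>_def by (intro sum.cong) (auto simp: zero)
      then have "(\<Sum>r\<in>F2. (norm (T2 w r))\<^sup>2) \<le> C\<^sup>2 * (\<Sum>i<n. \<Sum>q\<in>D2. (norm (\<zeta> i q))\<^sup>2)"
        using row_boundD[OF row, of F2 D2 \<zeta>] fin by simp
      also have "(\<Sum>i<n. \<Sum>q\<in>D2. (norm (\<zeta> i q))\<^sup>2) = (\<Sum>i<n. if i # w \<in> D1 then N (i # w) else 0)"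
        unfolding \<zeta>_def N_def by (intro sum.cong) auto
      finally show ?thesis .
    qed
    then have "(\<Sum>w\<in>F1. \<Sum>r\<in>F2. (norm (T2 w r))\<^sup>2) \<le> (\<Sum>w\<in>F1. C\<^sup>2 * (\<Sum>i<n. if i # w \<in> D1 then N (i # w) else 0))"
      by (intro sum_mono)
    also have "\<dots> = C\<^sup>2 * (\<Sum>(w, i)\<in>F1 \<times> {..<n}. if i # w \<in> D1 then N (i # w) else 0)"
      by (simp add: sum_distrib_left sum.cartesian_product split_beta)
    also have "(\<Sum>(w, i)\<in>F1 \<times> {..<n}. if i # w \<in> D1 then N (i # w) else 0)
        = (\<Sum>(w, i)\<in>{(w, i) \<in> F1 \<times> {..<n}. i # w \<in> D1}. N (i # w))"
      by (rule sum.mono_neutral_cong_right) (use fin in \<open>auto split: if_splits\<close>)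
    \<comment> \<open>Prefixing is injective in the pair of letter and word, so each vector of
      \<open>\<xi>\<close> is counted at most once.\<close>
    also have "\<dots> = sum N ((\<lambda>(w, i). i # w) ` {(w, i) \<in> F1 \<times> {..<n}. i # w \<in> D1})"
      by (subst sum.reindex) (auto simp: inj_on_def intro!: sum.cong)
    also have "\<dots> \<le> sum N D1"
      using fin by (intro sum_mono2) (auto simp: N_def intro!: sum_nonneg)
    finally have le2: "(\<Sum>w\<in>F1. \<Sum>r\<in>F2. (norm (T2 w r))\<^sup>2) \<le> C\<^sup>2 * (\<Sum>v\<in>D1. \<Sum>r'\<in>D2. (norm (\<xi> (v, r')))\<^sup>2)"
      by (auto simp: N_def mult_left_mono)
    have "(\<Sum>p\<in>F1 \<times> F2. (norm (\<Sum>q\<in>D1 \<times> D2. kernel_matrix n word_rel b p q (\<xi> q)))\<^sup>2)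
       = (\<Sum>w\<in>F1. \<Sum>r\<in>F2. (norm (T1 w r + T2 w r))\<^sup>2)"
      by (subst sum.cartesian_product') (simp only: S)
    also have "\<dots> \<le> (\<Sum>w\<in>F1. \<Sum>r\<in>F2. 2 * (norm (T1 w r))\<^sup>2 + 2 * (norm (T2 w r))\<^sup>2)"
      by (intro sum_mono norm_add_power2_le)
    also have "\<dots> = 2 * (\<Sum>w\<in>F1. \<Sum>r\<in>F2. (norm (T1 w r))\<^sup>2) + 2 * (\<Sum>w\<in>F1. \<Sum>r\<in>F2. (norm (T2 w r))\<^sup>2)"
      by (simp add: sum.distrib sum_distrib_left)
    \<comment> \<open>Each part contributes the square of \<open>C\<close>, doubled by the crude
      bound on the norm of a sum; the total 4 is the square of the factor 2.\<close>
    also have "\<dots> \<le> (2 * C)\<^sup>2 * (\<Sum>v\<in>D1. \<Sum>r'\<in>D2. (norm (\<xi> (v, r')))\<^sup>2)"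
      using le1 le2 by (simp add: power_mult_distrib)
    finally show ?thesis
      by (simp add: sum.cartesian_product')
  qed
  moreover have "F \<subseteq> F1 \<times> F2" "D \<subseteq> D1 \<times> D2"
    by (force simp: F1_def F2_def D1_def D2_def)+
  moreover have "finite (F1 \<times> F2)" "finite (D1 \<times> D2)"
    using fin by auto
  ultimately show "\<exists>F' D'. finite F' \<and> F \<subseteq> F' \<and> finite D' \<and> D \<subseteq> D' \<and>
      (\<forall>\<xi>. (\<Sum>p\<in>F'. (norm (\<Sum>q\<in>D'. kernel_matrix n word_rel b p q (\<xi> q)))\<^sup>2)
         \<le> (2 * C)\<^sup>2 * (\<Sum>q\<in>D'. (norm (\<xi> q))\<^sup>2))"
    by blast
qed (auto simp: kernel_matrix_def zero split_beta intro!: sum.neutral)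

section \<open>Reduced words\<close>

text \<open>Right multiplication of a reduced word by the generator \<open>g\<^sub>l\<close>.\<close>

definition rmul :: "nat \<Rightarrow> nat list \<Rightarrow> nat list" where
  "rmul l w = (if w \<noteq> [] \<and> last w = l then butlast w else w @ [l])"

lemma distinct_adj_snoc: "distinct_adj (w @ [l]) \<longleftrightarrow> distinct_adj w \<and> (w \<noteq> [] \<longrightarrow> last w \<noteq> l)"
  by (auto simp: distinct_adj_append_iff)

lemma rmul_cases:
  obtains v where "w = v @ [l]" "rmul l w = v" | "rmul l w = w @ [l]" "w \<noteq> [] \<longrightarrow> last w \<noteq> l"
proof (cases "w \<noteq> [] \<and> last w = l")
  case True
  then show ?thesis
    using append_butlast_last_id[of w] that(1)[of "butlast w"] by (auto simp: rmul_def)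
qed (use that(2) in \<open>auto simp: rmul_def\<close>)

lemma distinct_adj_rmul:
  assumes "distinct_adj w"
  shows "distinct_adj (rmul l w)"
  by (rule rmul_cases[of w l]) (use assms in \<open>auto simp: distinct_adj_snoc\<close>)

lemma rmul_rmul:
  assumes "distinct_adj w"
  shows "rmul l (rmul l w) = w"
  by (rule rmul_cases[of w l]) (use assms in \<open>auto simp: distinct_adj_snoc rmul_def\<close>)

text \<open>Right multiplication touches only the last letter, which lies in the common tail unless
  \<open>w\<close> is empty. For \<open>w\<close> empty and \<open>l = i\<close> the words
  \<open>[i]\<close> and \<open>[]\<close> are exchanged, which the symmetric form of
  \<open>word_rel\<close> allows.\<close>

lemma word_rel_rmul_aux: "distinct_adj (i # w) \<Longrightarrow> word_rel i (rmul l (i # w)) (rmul l w)"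
  by (cases w) (auto simp: word_rel_def rmul_def)

lemma word_rel_sym: "word_rel i w w' \<longleftrightarrow> word_rel i w' w"
  by (auto simp: word_rel_def)

text \<open>Left and right multiplication commute. The converse is the forward implication for the
  translated words, since \<open>rmul l\<close> is an involution.\<close>

lemma word_rel_rmul:
  assumes "distinct_adj w" "distinct_adj w'"
  shows "word_rel i (rmul l w) (rmul l w') \<longleftrightarrow> word_rel i w w'"
proof -
  have *: "word_rel i (rmul l v) (rmul l v')" if "word_rel i v v'" "distinct_adj v" "distinct_adj v'" for v v'
    using that(1) word_rel_rmul_aux[of i v l] word_rel_rmul_aux[of i v' l] that(2,3)
    by (auto simp: word_rel_def[of _ v] intro: word_rel_sym[THEN iffD1])
  show ?thesis
    using *[of w w'] *[of "rmul l w" "rmul l w'"] assms by (auto simp: rmul_rmul distinct_adj_rmul)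
qed

definition widx :: "nat \<Rightarrow> nat list list set" where
  "widx j = {p. length p = j \<and> (\<forall>r<j. distinct_adj (p ! r))}"

definition shift :: "nat \<Rightarrow> nat \<Rightarrow> nat list list \<Rightarrow> nat list list" where
  "shift r l p = p[r := rmul l (p ! r)]"

lemma shift_in: "p \<in> widx j \<Longrightarrow> r < j \<Longrightarrow> shift r l p \<in> widx j"
  by (auto simp: widx_def shift_def nth_list_update distinct_adj_rmul)

lemma shift_shift: "p \<in> widx j \<Longrightarrow> r < j \<Longrightarrow> shift r l (shift r l p) = p"
  by (auto simp: widx_def shift_def rmul_rmul list_update_id)

lemma bij_shift: "r < j \<Longrightarrow> bij_betw (shift r l) (widx j) (widx j)"
  by (rule bij_betw_byWitness[where f' = "shift r l"]) (auto simp: shift_in shift_shift)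

section \<open>Invariant matrices\<close>

text \<open>The index set may be infinite; restricting to nonzero entries makes the sum finite when
  the rows of \<open>c\<close> are.\<close>

definition mmul :: "('i, 'a::cstar_algebra) matr \<Rightarrow> ('i, 'a) matr \<Rightarrow> ('i, 'a) matr" where
  "mmul c d p q = (\<Sum>r | c p r \<noteq> 0. c p r * d r q)"

definition mstar :: "('i, 'a::cstar_algebra) matr \<Rightarrow> ('i, 'a) matr" where
  "mstar c p q = star (c q p)"

definition mimag :: "('i, 'a::cstar_algebra) matr \<Rightarrow> ('i, 'a) matr" where
  "mimag c p q = scaleC \<i> (c p q)"

definition rcfin :: "('i, 'a::zero) matr \<Rightarrow> bool" where
  "rcfin c \<longleftrightarrow> (\<forall>p. finite {q. c p q \<noteq> 0}) \<and> (\<forall>q. finite {p. c p q \<noteq> 0})"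

text \<open>
  Matrices over \<open>G\<^sup>j\<close> invariant under right translations: the group algebra \<open>A[G\<^sup>j]\<close>
  in its left regular representation.
\<close>

definition walg :: "nat \<Rightarrow> (nat list list, 'a::cstar_algebra) matr set" where
  "walg j = {c. rcfin c \<and> (\<forall>p q. c p q \<noteq> 0 \<longrightarrow> p \<in> widx j \<and> q \<in> widx j) \<and>
     (\<forall>r<j. \<forall>l. \<forall>p\<in>widx j. \<forall>q\<in>widx j. c (shift r l p) (shift r l q) = c p q)}"

lemma walgD:
  assumes "c \<in> walg j"
  shows "rcfin c" "c p q \<noteq> 0 \<Longrightarrow> p \<in> widx j" "c p q \<noteq> 0 \<Longrightarrow> q \<in> widx j"
    "r < j \<Longrightarrow> p \<in> widx j \<Longrightarrow> q \<in> widx j \<Longrightarrow> c (shift r l p) (shift r l q) = c p q"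
  using assms unfolding walg_def by blast+

lemma star_zero [simp]: "star (0::'a::cstar_algebra) = 0"
  using star_add[of 0 "0::'a"] by simp

lemma star_eq_zero_iff [simp]: "star x = 0 \<longleftrightarrow> (x::'a::cstar_algebra) = 0"
  by (metis star_star star_zero)

lemma scaleC_eq_zero_iff: "c \<noteq> 0 \<Longrightarrow> scaleC c x = 0 \<longleftrightarrow> (x::'a::complex_vector) = 0"
  by (metis mult.commute nonzero_mult_div_cancel_left right_inverse scaleC_one scaleC_scaleC scaleC_zero_right)

lemma rcfin_subset:
  assumes "rcfin c" "\<And>p q. d p q \<noteq> 0 \<Longrightarrow> c p q \<noteq> 0"
  shows "rcfin d"
proof -
  have "{q. d p q \<noteq> 0} \<subseteq> {q. c p q \<noteq> 0}" "{p. d p q \<noteq> 0} \<subseteq> {p. c p q \<noteq> 0}" for p q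
    using assms(2) by auto
  then show ?thesis
    using assms(1) unfolding rcfin_def by (meson finite_subset)
qed

lemma mmul_eq:
  assumes "finite R" "{r. c p r \<noteq> 0} \<subseteq> R"
  shows "mmul c d p q = (\<Sum>r\<in>R. c p r * d r q)"
  unfolding mmul_def by (rule sum.mono_neutral_left) (use assms in auto)

lemma rcfin_mmul:
  assumes "rcfin c" "rcfin d"
  shows "rcfin (mmul c d)"
proof -
  have ex: "\<exists>r. c p r \<noteq> 0 \<and> d r q \<noteq> 0" if "mmul c d p q \<noteq> 0" for p q
    using that unfolding mmul_def by (metis (mono_tags, lifting) mult_zero_right mem_Collect_eq sum.neutral)
  have "{q. mmul c d p q \<noteq> 0} \<subseteq> (\<Union>r\<in>{r. c p r \<noteq> 0}. {q. d r q \<noteq> 0})"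
    "{p. mmul c d p q \<noteq> 0} \<subseteq> (\<Union>r\<in>{r. d r q \<noteq> 0}. {p. c p r \<noteq> 0})" for p q
    using ex by blast+
  then show ?thesis
    using assms unfolding rcfin_def by (metis (no_types, lifting) finite_UN_I finite_subset mem_Collect_eq)
qed

text \<open>A right translation permutes the summation index of the product, so invariance of the
  factors passes to it.\<close>

lemma walg_mmul:
  fixes c d :: "(nat list list, 'a::cstar_algebra) matr"
  assumes c: "c \<in> walg j" and d: "d \<in> walg j"
  shows "mmul c d \<in> walg j"
  unfolding walg_def
proof (intro CollectI conjI allI impI ballI)
  show "rcfin (mmul c d)"
    by (rule rcfin_mmul[OF walgD(1)[OF c] walgD(1)[OF d]])
  show "p \<in> widx j" "q \<in> widx j" if "mmul c d p q \<noteq> 0" for p q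
  proof -
    obtain r where "c p r \<noteq> 0" "d r q \<noteq> 0"
      using \<open>mmul c d p q \<noteq> 0\<close> unfolding mmul_def
      by (metis (mono_tags, lifting) mult_zero_right mem_Collect_eq sum.neutral)
    then show "p \<in> widx j" "q \<in> widx j"
      using walgD(2)[OF c] walgD(3)[OF d] by blast+
  qed
  fix r l p q assume r: "r < j" and p: "p \<in> widx j" and q: "q \<in> widx j"
  have "mmul c d (shift r l p) (shift r l q) = (\<Sum>s\<in>shift r l ` {s. c p s \<noteq> 0}. c (shift r l p) s * d s (shift r l q))"
  proof (rule mmul_eq)
    show "finite (shift r l ` {s. c p s \<noteq> 0})"
      using walgD(1)[OF c] by (simp add: rcfin_def)
    show "{s. c (shift r l p) s \<noteq> 0} \<subseteq> shift r l ` {s. c p s \<noteq> 0}"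
    proof safe
      fix s assume s: "c (shift r l p) s \<noteq> 0"
      then have "s \<in> widx j" using walgD(3)[OF c] by blast
      then show "s \<in> shift r l ` {s. c p s \<noteq> 0}"
        using s walgD(4)[OF c r p shift_in[OF _ r], of s l l] r
        by (intro image_eqI[of _ _ "shift r l s"]) (auto simp: shift_shift)
    qed
  qed
  also have "\<dots> = (\<Sum>s | c p s \<noteq> 0. c (shift r l p) (shift r l s) * d (shift r l s) (shift r l q))"
    by (rule sum.reindex_cong[of "shift r l"])
      (use bij_shift[OF r, of l] walgD(3)[OF c] in \<open>auto simp: bij_betw_def intro: inj_on_subset\<close>)
  also have "\<dots> = mmul c d p q"
    unfolding mmul_def using walgD(3)[OF c] walgD(4)[OF c r p] walgD(4)[OF d r _ q] by (intro sum.cong) auto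
  finally show "mmul c d (shift r l p) (shift r l q) = mmul c d p q" .
qed

lemma walg_mstar: "c \<in> walg j \<Longrightarrow> mstar c \<in> walg j"
  unfolding walg_def rcfin_def mstar_def by simp

lemma walg_mimag: "c \<in> walg j \<Longrightarrow> mimag c \<in> walg j"
  unfolding walg_def rcfin_def mimag_def by (simp add: scaleC_eq_zero_iff)

lemma subspace_walg: "subspace (walg j :: (nat list list, 'a::cstar_algebra) matr set)"
proof (rule subspaceI)
  show "0 \<in> (walg j :: (nat list list, 'a::cstar_algebra) matr set)"
    by (simp add: walg_def rcfin_def)
  fix c d :: "(nat list list, 'a) matr" and x :: real
  assume c: "c \<in> walg j"
  show "x *\<^sub>R c \<in> walg j"
    using c unfolding walg_def by (auto intro: rcfin_subset[of c])
  assume d: "d \<in> walg j"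
  have "{q. (c + d) p q \<noteq> 0} \<subseteq> {q. c p q \<noteq> 0} \<union> {q. d p q \<noteq> 0}"
    "{p. (c + d) p q \<noteq> 0} \<subseteq> {p. c p q \<noteq> 0} \<union> {p. d p q \<noteq> 0}" for p q
    by auto
  then have "rcfin (c + d)"
    using c d unfolding walg_def rcfin_def by (metis (no_types, lifting) finite_UnI finite_subset mem_Collect_eq)
  moreover have "p \<in> widx j \<and> q \<in> widx j" if "(c + d) p q \<noteq> 0" for p q
  proof -
    have "c p q \<noteq> 0 \<or> d p q \<noteq> 0" using that by auto
    then show ?thesis using walgD(2,3)[OF c] walgD(2,3)[OF d] by blast
  qed
  moreover have "(c + d) (shift r l p) (shift r l q) = (c + d) p q"
    if "r < j" "p \<in> widx j" "q \<in> widx j" for r l p q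
    using walgD(4)[OF c that] walgD(4)[OF d that] by simp
  ultimately show "c + d \<in> walg j"
    unfolding walg_def by blast
qed

section \<open>Group algebra elements as operators on finitely supported families\<close>

locale embedded =
  fixes \<pi> :: "'a::cstar_algebra \<Rightarrow> ('h::complex_hilbert \<Rightarrow>\<^sub>L 'h)"
  assumes emb: "cstar_embedding \<pi>"
begin

abbreviation ap :: "'a \<Rightarrow> 'h \<Rightarrow> 'h" where
  "ap a \<equiv> blinfun_apply (\<pi> a)"

lemma ap_add: "ap (a + b) \<xi> = ap a \<xi> + ap b \<xi>"
  using emb by (simp add: cstar_embedding_def blinfun.add_left)

lemma ap_scaleC: "ap (scaleC c a) \<xi> = scaleC c (ap a \<xi>)"
  using emb by (simp add: cstar_embedding_def)

lemma ap_scaleR: "ap (r *\<^sub>R a) \<xi> = r *\<^sub>R ap a \<xi>"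
  by (metis ap_scaleC scaleC_of_real)

lemma ap_zero [simp]: "ap 0 \<xi> = 0"
  using ap_scaleR[of 0 0 \<xi>] by simp

lemma ap_sum: "ap (sum f A) \<xi> = (\<Sum>i\<in>A. ap (f i) \<xi>)"
  by (induction A rule: infinite_finite_induct) (auto simp: ap_add)

lemma ap_mult: "ap (a * b) \<xi> = ap a (ap b \<xi>)"
  using emb by (simp add: cstar_embedding_def)

lemma ap_right: "ap a (\<xi> + \<eta>) = ap a \<xi> + ap a \<eta>" "ap a (r *\<^sub>R \<xi>) = r *\<^sub>R ap a \<xi>" "ap a 0 = 0"
  "ap a (sum f A) = (\<Sum>i\<in>A. ap a (f i))"
  by (simp_all add: blinfun.add_right blinfun.scaleR_right blinfun.zero_right blinfun.sum_right)

lemma rinner_ap_star: "rinner (ap (star a) \<xi>) \<eta> = rinner \<xi> (ap a \<eta>)"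
  using emb by (simp add: cstar_embedding_def rinner_def)

lemma norm_ap_le: "norm (ap a \<xi>) \<le> norm a * norm \<xi>"
  using emb norm_blinfun[of "\<pi> a" \<xi>] by (simp add: cstar_embedding_def)

lemma norm_le_of_ap:
  assumes "\<And>\<xi>. norm (ap a \<xi>) \<le> C * norm \<xi>" "0 \<le> C"
  shows "norm a \<le> C"
  using emb norm_blinfun_bound[of C "\<pi> a"] assms by (simp add: cstar_embedding_def)

definition op :: "('i, 'a) matr \<Rightarrow> ('i, 'h) fsv \<Rightarrow> ('i, 'h) fsv" where
  "op c \<xi> = Abs_fsv (\<lambda>p. \<Sum>q | c p q \<noteq> 0. ap (c p q) (fsv_nth \<xi> q))"

lemma nth_op:
  assumes "rcfin c"
  shows "fsv_nth (op c \<xi>) p = (\<Sum>q | c p q \<noteq> 0. ap (c p q) (fsv_nth \<xi> q))"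
proof -
  have "{p. (\<Sum>q | c p q \<noteq> 0. ap (c p q) (fsv_nth \<xi> q)) \<noteq> 0} \<subseteq> (\<Union>q\<in>supp \<xi>. {p. c p q \<noteq> 0})"
  proof safe
    fix p assume "(\<Sum>q | c p q \<noteq> 0. ap (c p q) (fsv_nth \<xi> q)) \<noteq> 0"
    then obtain q where "c p q \<noteq> 0" "ap (c p q) (fsv_nth \<xi> q) \<noteq> 0"
      by (metis (mono_tags, lifting) mem_Collect_eq sum.neutral)
    then show "p \<in> (\<Union>q\<in>supp \<xi>. {p. c p q \<noteq> 0})"
      using ap_right(3)[of "c p q"] by (cases "fsv_nth \<xi> q = 0") (auto simp: supp_def)
  qed
  then have "finite {p. (\<Sum>q | c p q \<noteq> 0. ap (c p q) (fsv_nth \<xi> q)) \<noteq> 0}"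
    by (rule finite_subset) (use assms in \<open>auto simp: rcfin_def\<close>)
  then show ?thesis
    unfolding op_def by (subst fsv_nth_Abs) auto
qed

lemma nth_op_supp:
  assumes "rcfin c" "finite D" "supp \<xi> \<subseteq> D"
  shows "fsv_nth (op c \<xi>) p = (\<Sum>q\<in>D. ap (c p q) (fsv_nth \<xi> q))"
proof -
  have "fsv_nth \<xi> q = 0" if "q \<notin> D" for q
    using assms(3) that by (auto simp: supp_def)
  then show ?thesis
    unfolding nth_op[OF assms(1)]
    by (intro sum.mono_neutral_cong) (use assms in \<open>auto simp: rcfin_def ap_right\<close>)
qed

lemma op_mmul:
  assumes "rcfin c" "rcfin d"
  shows "op (mmul c d) \<xi> = op c (op d \<xi>)"
proof (rule fsv_eqI)
  fix p
  have "fsv_nth (op (mmul c d) \<xi>) p = (\<Sum>q\<in>supp \<xi>. \<Sum>r | c p r \<noteq> 0. ap (c p r) (ap (d r q) (fsv_nth \<xi> q)))"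
    by (subst nth_op_supp[OF rcfin_mmul[OF assms] finite_supp order_refl])
      (simp add: mmul_def ap_sum ap_mult)
  also have "\<dots> = (\<Sum>r | c p r \<noteq> 0. ap (c p r) (fsv_nth (op d \<xi>) r))"
    by (subst sum.swap) (simp add: nth_op_supp[OF assms(2) finite_supp order_refl] ap_right)
  finally show "fsv_nth (op (mmul c d) \<xi>) p = fsv_nth (op c (op d \<xi>)) p"
    by (simp add: nth_op[OF assms(1)])
qed

lemma rcfin_mstar: "rcfin c \<Longrightarrow> rcfin (mstar c)"
  by (auto simp: rcfin_def mstar_def)

lemma inner_op_mstar:
  assumes "rcfin c"
  shows "inner (op (mstar c) \<xi>) \<eta> = inner \<xi> (op c \<eta>)"
proof -
  define P where "P = supp \<xi> \<union> supp \<eta> \<union> supp (op (mstar c) \<xi>)"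
  have P: "finite P" "supp \<xi> \<subseteq> P" "supp \<eta> \<subseteq> P" "supp (op (mstar c) \<xi>) \<subseteq> P"
    by (auto simp: P_def)
  have "inner (op (mstar c) \<xi>) \<eta> = (\<Sum>p\<in>P. rinner (\<Sum>q\<in>P. ap (star (c q p)) (fsv_nth \<xi> q)) (fsv_nth \<eta> p))"
    by (simp add: inner_fsv_eq[OF P(1,4)] nth_op_supp[OF rcfin_mstar[OF assms] P(1,2)] mstar_def)
  also have "\<dots> = (\<Sum>q\<in>P. \<Sum>p\<in>P. rinner (fsv_nth \<xi> q) (ap (c q p) (fsv_nth \<eta> p)))"
    by (subst sum.swap) (simp add: rinner_sum_left rinner_ap_star)
  also have "\<dots> = inner \<xi> (op c \<eta>)"
    by (simp add: inner_fsv_eq[OF P(1,2)] nth_op_supp[OF assms P(1,3)] rinner_sum_right)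
  finally show ?thesis .
qed

lemma linear_op: "rcfin c \<Longrightarrow> linear (op c)"
  by (rule linearI; rule fsv_eqI) (simp_all add: nth_op ap_right sum.distrib scaleR_sum_right)

lemma star_algebra_rep_walg: "star_algebra_rep (walg j) mmul mstar mimag op"
proof (rule star_algebra_rep.intro)
  fix x y :: "(nat list list, 'a) matr" and \<xi> \<eta> :: "(nat list list, 'h) fsv" and r :: real
  show "subspace (walg j :: (nat list list, 'a) matr set)"
    by (rule subspace_walg)
  assume x: "x \<in> walg j"
  then have rx: "rcfin x" by (rule walgD)
  show "mstar x \<in> walg j" "mimag x \<in> walg j"
    using x by (auto intro: walg_mstar walg_mimag)
  show "mstar (mimag x) = - mimag (mstar x)"
    by (simp add: mstar_def mimag_def fun_eq_iff star_scaleC)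
      (metis scaleC_minus_one scaleC_scaleC mult_minus1 minus_mult_commute)
  show "mimag (mimag x) = - x"
    by (simp add: mimag_def fun_eq_iff scaleC_scaleC)
  show "mimag (- x) = - mimag x"
    by (simp add: mimag_def fun_eq_iff scaleC_minus_right)
  show "linear (op x)"
    using rx by (rule linear_op)
  have "rcfin (r *\<^sub>R x)"
    using subspace_scale[OF subspace_walg x] by (rule walgD)
  then show "op (r *\<^sub>R x) \<xi> = r *\<^sub>R op x \<xi>"
    by (intro fsv_eqI) (simp add: nth_op_supp[OF _ finite_supp order_refl] rx ap_scaleR scaleR_sum_right)
  show "inner (op (mstar x) \<xi>) \<eta> = inner \<xi> (op x \<eta>)"
    using rx by (rule inner_op_mstar)
  have "rcfin (mimag x)"
    using walg_mimag[OF x] by (rule walgD)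
  then have "fsv_nth (op (mimag x) \<xi>) p = scaleC \<i> (fsv_nth (op x \<xi>) p)" for p
    by (simp add: nth_op_supp[OF _ finite_supp order_refl] rx mimag_def ap_scaleC scaleC_sum_right)
  then have nth: "norm (fsv_nth (op (mimag x) \<xi>) p) = norm (fsv_nth (op x \<xi>) p)" for p
    by (simp add: norm_scaleC)
  define P where "P = supp (op (mimag x) \<xi>) \<union> supp (op x \<xi>)"
  have "(norm (op (mimag x) \<xi>))\<^sup>2 = (norm (op x \<xi>))\<^sup>2"
    using norm_fsv_power2[of P "op (mimag x) \<xi>"] norm_fsv_power2[of P "op x \<xi>"]
    by (simp add: nth P_def)
  then show "norm (op (mimag x) \<xi>) = norm (op x \<xi>)"
    by simp
  assume y: "y \<in> walg j"
  then have ry: "rcfin y" by (rule walgD)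
  show "mmul x y \<in> walg j"
    using x y by (rule walg_mmul)
  show "mmul x (- y) = - mmul x y"
    by (simp add: mmul_def fun_eq_iff sum_negf)
  show "mmul (- x) y = - mmul x y"
    by (simp add: mmul_def fun_eq_iff sum_negf)
  show "mmul x (mimag y) = mimag (mmul x y)"
    by (simp add: mmul_def mimag_def fun_eq_iff scaleC_mult_right scaleC_sum_right)
  show "mmul (mimag x) y = mimag (mmul x y)"
    by (simp add: mmul_def mimag_def fun_eq_iff scaleC_mult_left scaleC_sum_right scaleC_eq_zero_iff)
  show "mimag (x + y) = mimag x + mimag y"
    by (simp add: mimag_def fun_eq_iff scaleC_add_right)
  have "rcfin (x + y)"
    using subspace_add[OF subspace_walg x y] by (rule walgD)
  then show "op (x + y) \<xi> = op x \<xi> + op y \<xi>"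
    by (intro fsv_eqI) (simp add: nth_op_supp[OF _ finite_supp order_refl] rx ry ap_add sum.distrib)
  show "op (mmul x y) \<xi> = op x (op y \<xi>)"
    using rx ry by (rule op_mmul)
qed

text \<open>For a fixed \<open>\<xi>\<close> only finitely many rows and columns matter, namely the
  supports of \<open>\<xi>\<close> and of its images, so truncated bounds already control the full
  operators.\<close>

lemma col_bound_op:
  assumes b: "\<And>i. i < n \<Longrightarrow> b i \<in> walg j"
    and col: "col_bound n (widx j) (widx j) (\<lambda>i p q. ap (b i p q)) K"
  shows "(\<Sum>i<n. (norm (op (b i) \<xi>))\<^sup>2) \<le> K\<^sup>2 * (norm \<xi>)\<^sup>2"
proof -
  define D where "D = supp \<xi> \<inter> widx j"
  define F where "F = (\<Union>i<n. supp (op (b i) \<xi>))"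
  have r: "rcfin (b i)" if "i < n" for i
    using b[OF that] by (rule walgD)
  have nth: "fsv_nth (op (b i) \<xi>) p = (\<Sum>q\<in>D. ap (b i p q) (fsv_nth \<xi> q))" if "i < n" for i p
    unfolding nth_op_supp[OF r[OF that] finite_supp order_refl] D_def
  proof (rule sum.mono_neutral_right)
    have "ap (b i p q) (fsv_nth \<xi> q) = 0" if "q \<notin> widx j" for q
      using walgD(3)[OF b[OF \<open>i < n\<close>], of p q] that by (cases "b i p q = 0") auto
    then show "\<forall>q\<in>supp \<xi> - supp \<xi> \<inter> widx j. ap (b i p q) (fsv_nth \<xi> q) = 0"
      by auto
  qed auto
  have F: "F \<subseteq> widx j"
  proof
    fix p assume "p \<in> F"
    then obtain i where i: "i < n" "fsv_nth (op (b i) \<xi>) p \<noteq> 0"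
      by (auto simp: F_def supp_def)
    from i(2) obtain q where "ap (b i p q) (fsv_nth \<xi> q) \<noteq> 0"
      unfolding nth[OF i(1)] by (rule sum.not_neutral_contains_not_neutral)
    then have "b i p q \<noteq> 0" by auto
    then show "p \<in> widx j" by (rule walgD(2)[OF b[OF i(1)]])
  qed
  have fin: "finite D" "finite F" by (auto simp: D_def F_def)
  have "(\<Sum>i<n. (norm (op (b i) \<xi>))\<^sup>2) = (\<Sum>i<n. \<Sum>p\<in>F. (norm (\<Sum>q\<in>D. ap (b i p q) (fsv_nth \<xi> q)))\<^sup>2)"
  proof (rule sum.cong)
    fix i assume i: "i \<in> {..<n}"
    then have "supp (op (b i) \<xi>) \<subseteq> F" by (auto simp: F_def)
    then show "(norm (op (b i) \<xi>))\<^sup>2 = (\<Sum>p\<in>F. (norm (\<Sum>q\<in>D. ap (b i p q) (fsv_nth \<xi> q)))\<^sup>2)"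
      using i fin by (simp add: norm_fsv_power2[of F] nth)
  qed simp
  also have "\<dots> \<le> K\<^sup>2 * (\<Sum>q\<in>D. (norm (fsv_nth \<xi> q))\<^sup>2)"
    by (rule col_boundD[OF col]) (use fin F in \<open>auto simp: D_def\<close>)
  also have "\<dots> \<le> K\<^sup>2 * (norm \<xi>)\<^sup>2"
    unfolding norm_fsv_power2[OF finite_supp order_refl]
    by (intro mult_left_mono sum_mono2) (auto simp: D_def)
  finally show ?thesis .
qed

lemma matrix_bound_of_op:
  fixes c :: "('i, 'a) matr"
  assumes c: "rcfin c" and bd: "\<And>\<xi>. norm (op c \<xi>) \<le> K * norm \<xi>"
  shows "matrix_bound I J (\<lambda>p q. ap (c p q)) K"
  unfolding matrix_bound_def
proof (intro allI impI, elim conjE)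
  fix F D and \<xi> :: "'i \<Rightarrow> 'h" assume F: "finite F" "F \<subseteq> I" and D: "finite D" "D \<subseteq> J"
  define \<zeta> where "\<zeta> = Abs_fsv (\<lambda>q. if q \<in> D then \<xi> q else 0)"
  have nth: "fsv_nth \<zeta> q = (if q \<in> D then \<xi> q else 0)" for q
    unfolding \<zeta>_def by (subst fsv_nth_Abs) (auto intro: finite_subset[OF _ D(1)])
  then have supp: "supp \<zeta> \<subseteq> D"
    by (auto simp: supp_def split: if_splits)
  have "(\<Sum>p\<in>F. (norm (\<Sum>q\<in>D. ap (c p q) (\<xi> q)))\<^sup>2) = (\<Sum>p\<in>F. (norm (fsv_nth (op c \<zeta>) p))\<^sup>2)"
    by (simp add: nth_op_supp[OF c D(1) supp] nth)
  also have "\<dots> \<le> (\<Sum>p\<in>F \<union> supp (op c \<zeta>). (norm (fsv_nth (op c \<zeta>) p))\<^sup>2)"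
    by (rule sum_mono2) (use F in auto)
  also have "\<dots> = (norm (op c \<zeta>))\<^sup>2"
    by (rule norm_fsv_power2[symmetric]) (use F in auto)
  also have "\<dots> \<le> (K * norm \<zeta>)\<^sup>2"
    by (intro power_mono bd) auto
  also have "\<dots> = K\<^sup>2 * (\<Sum>q\<in>D. (norm (\<xi> q))\<^sup>2)"
    unfolding power_mult_distrib norm_fsv_power2[OF D(1) supp] by (simp add: nth)
  finally show "(\<Sum>p\<in>F. (norm (\<Sum>q\<in>D. ap (c p q) (\<xi> q)))\<^sup>2) \<le> K\<^sup>2 * (\<Sum>q\<in>D. (norm (\<xi> q))\<^sup>2)" .
qed

end

text \<open>Cauchy-Schwarz between \<open>\<xi>\<close> and \<open>M\<close> applied to the image of
  \<open>\<xi>\<close>, as for \<open>norm_adjoint_le\<close>. It turns row bounds into column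
  bounds of adjoints, the second input of the inequality.\<close>

lemma matrix_bound_adjoint:
  fixes M :: "'i \<Rightarrow> 'j \<Rightarrow> 'h::complex_hilbert \<Rightarrow> 'h"
  assumes bd: "matrix_bound I J M C" and C: "0 \<le> C"
    and adj: "\<And>p q \<xi> \<eta>. rinner (N q p \<xi>) \<eta> = rinner \<xi> (M p q \<eta>)"
  shows "matrix_bound J I N C"
  unfolding matrix_bound_def
proof (intro allI impI, elim conjE)
  fix F D and \<xi> :: "'i \<Rightarrow> 'h" assume F: "finite F" "F \<subseteq> J" and D: "finite D" "D \<subseteq> I"
  define y where "y q = (\<Sum>p\<in>D. N q p (\<xi> p))" for q
  define T where "T = (\<Sum>q\<in>F. (norm (y q))\<^sup>2)"
  define S where "S = (\<Sum>p\<in>D. (norm (\<xi> p))\<^sup>2)"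
  have pos: "0 \<le> T" "0 \<le> S" by (auto simp: T_def S_def intro: sum_nonneg)
  have "T = (\<Sum>q\<in>F. \<Sum>p\<in>D. rinner (\<xi> p) (M p q (y q)))"
    unfolding T_def rinner_self[symmetric]
    by (intro sum.cong refl, subst (1) y_def) (simp add: rinner_sum_left adj)
  also have "\<dots> = (\<Sum>p\<in>D. rinner (\<xi> p) (\<Sum>q\<in>F. M p q (y q)))"
    by (subst sum.swap) (simp add: rinner_sum_right)
  also have "\<dots> \<le> (\<Sum>p\<in>D. norm (\<xi> p) * norm (\<Sum>q\<in>F. M p q (y q)))"
    by (intro sum_mono rinner_le_norm)
  also have "\<dots> \<le> L2_set (\<lambda>p. norm (\<xi> p)) D * L2_set (\<lambda>p. norm (\<Sum>q\<in>F. M p q (y q))) D"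
    using L2_set_mult_ineq[of "\<lambda>p. norm (\<xi> p)" "\<lambda>p. norm (\<Sum>q\<in>F. M p q (y q))" D] by simp
  also have "\<dots> \<le> sqrt S * sqrt (C\<^sup>2 * T)"
    unfolding L2_set_def S_def T_def
    by (intro mult_left_mono real_sqrt_le_mono matrix_boundD[OF bd D F]) (auto intro: sum_nonneg)
  also have "\<dots> = C * sqrt S * sqrt T"
    using C by (simp add: real_sqrt_mult)
  finally have le: "sqrt T * sqrt T \<le> C * sqrt S * sqrt T"
    using pos by simp
  have "sqrt T \<le> C * sqrt S"
  proof (cases "T = 0")
    case False
    then show ?thesis
      using mult_right_le_imp_le[OF le] pos by simp
  qed (use C pos in simp)
  then have "(sqrt T)\<^sup>2 \<le> (C * sqrt S)\<^sup>2"
    using pos by (intro power_mono) auto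
  then show "(\<Sum>q\<in>F. (norm (\<Sum>p\<in>D. N q p (\<xi> p)))\<^sup>2) \<le> C\<^sup>2 * (\<Sum>p\<in>D. (norm (\<xi> p))\<^sup>2)"
    using pos by (simp add: power_mult_distrib T_def S_def y_def)
qed

lemma row_bound_adjoint:
  fixes b :: "nat \<Rightarrow> 'i \<Rightarrow> 'j \<Rightarrow> 'h::complex_hilbert \<Rightarrow> 'h"
  assumes bd: "col_bound n I J b C" and C: "0 \<le> C"
    and adj: "\<And>i p q \<xi> \<eta>. rinner (d i q p \<xi>) \<eta> = rinner \<xi> (b i p q \<eta>)"
  shows "row_bound n J I d C"
  using bd unfolding row_bound_def col_bound_def
  by (rule matrix_bound_adjoint) (use C adj in auto)

lemma col_bound_adjoint:
  fixes b :: "nat \<Rightarrow> 'i \<Rightarrow> 'j \<Rightarrow> 'h::complex_hilbert \<Rightarrow> 'h"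
  assumes bd: "row_bound n I J b C" and C: "0 \<le> C"
    and adj: "\<And>i p q \<xi> \<eta>. rinner (d i q p \<xi>) \<eta> = rinner \<xi> (b i p q \<eta>)"
  shows "col_bound n J I d C"
  using bd unfolding row_bound_def col_bound_def
  by (rule matrix_bound_adjoint) (use C adj in auto)

section \<open>Columns and rows under maps on the group algebra\<close>

locale bounded_map = A: embedded \<pi> + B: embedded \<rho>
  for \<pi> :: "'a::cstar_algebra \<Rightarrow> ('h::complex_hilbert \<Rightarrow>\<^sub>L 'h)"
    and \<rho> :: "'b::cstar_algebra \<Rightarrow> ('g::complex_hilbert \<Rightarrow>\<^sub>L 'g)" +
  fixes u :: "'a \<Rightarrow> 'b"
  assumes u: "bounded_clinear u"
begin

text \<open>For fixed \<open>\<xi>\<close>, applying \<open>G c\<close> to \<open>\<xi>\<close> is a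
  Hilbert-space-valued map of \<open>c\<close> with norm at most \<open>\<beta>\<close> times that
  of \<open>\<xi>\<close>. The inequality, with the square of \<open>K\<close> for both sums, gives
  the factor \<open>sqrt 2\<close>. The unimodular \<open>z\<close> also admits conjugate-linear
  \<open>G\<close>.\<close>

lemma col_bound_image:
  fixes G :: "(nat list list, 'a) matr \<Rightarrow> ('e, 'b) matr"
  assumes E: "finite E"
    and G_add: "\<And>c d p q. c \<in> walg j \<Longrightarrow> d \<in> walg j \<Longrightarrow> G (c + d) p q = G c p q + G d p q"
    and G_scale: "\<And>r c p q. c \<in> walg j \<Longrightarrow> G (r *\<^sub>R c) p q = r *\<^sub>R G c p q"
    and G_imag: "\<And>c p q. c \<in> walg j \<Longrightarrow> G (mimag c) p q = scaleC z (G c p q)" and z: "cmod z = 1"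
    and bd: "\<And>c. c \<in> walg j \<Longrightarrow> (\<And>\<xi>. norm (A.op c \<xi>) \<le> norm \<xi>)
      \<Longrightarrow> matrix_bound E E (\<lambda>p q. B.ap (G c p q)) \<beta>"
    and \<beta>: "0 \<le> \<beta>"
    and b: "\<And>i. i < n \<Longrightarrow> b i \<in> walg j" and K: "0 < K"
    and col: "col_bound n (widx j) (widx j) (\<lambda>i p q. A.ap (b i p q)) K"
    and row: "row_bound n (widx j) (widx j) (\<lambda>i p q. A.ap (b i p q)) K"
  shows "col_bound n E E (\<lambda>i p q. B.ap (G (b i) p q)) (sqrt 2 * \<beta> * K)"
  unfolding col_bound_def
proof (rule matrix_boundI)
  fix F D assume F: "F \<subseteq> {..<n} \<times> E" and D: "D \<subseteq> E"
  have "(\<Sum>p\<in>{..<n} \<times> E. (norm (\<Sum>q\<in>E. (case p of (i, p) \<Rightarrow> \<lambda>q. B.ap (G (b i) p q)) q (\<xi> q)))\<^sup>2)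
      \<le> (sqrt 2 * \<beta> * K)\<^sup>2 * (\<Sum>q\<in>E. (norm (\<xi> q))\<^sup>2)" for \<xi>
  proof -
    define N where "N = sqrt (\<Sum>q\<in>E. (norm (\<xi> q))\<^sup>2)"
    have N: "N\<^sup>2 = (\<Sum>q\<in>E. (norm (\<xi> q))\<^sup>2)" "0 \<le> N"
      by (auto simp: N_def sum_nonneg)
    define v where "v c = Abs_fsv (\<lambda>p. if p \<in> E then \<Sum>q\<in>E. B.ap (G c p q) (\<xi> q) else 0)" for c
    have nth: "fsv_nth (v c) p = (if p \<in> E then \<Sum>q\<in>E. B.ap (G c p q) (\<xi> q) else 0)" for c p
      unfolding v_def by (subst fsv_nth_Abs) (auto intro: finite_subset[OF _ E])
    then have supp: "supp (v c) \<subseteq> E" for c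
      by (auto simp: supp_def split: if_splits)
    have norm_v: "(norm (v c))\<^sup>2 = (\<Sum>p\<in>E. (norm (\<Sum>q\<in>E. B.ap (G c p q) (\<xi> q)))\<^sup>2)" for c
      by (simp add: norm_fsv_power2[OF E supp] nth)
    have "(\<Sum>i<n. (norm (v (b i)))\<^sup>2) \<le> (\<beta> * N)\<^sup>2 * (K\<^sup>2 + K\<^sup>2)"
    proof (rule star_algebra_rep.little_grothendieck[OF A.star_algebra_rep_walg])
      show "v (c + d) = v c + v d" if "c \<in> walg j" "d \<in> walg j" for c d
        by (rule fsv_eqI) (simp add: nth G_add[OF that] B.ap_add sum.distrib)
      show "v (r *\<^sub>R c) = r *\<^sub>R v c" if "c \<in> walg j" for r c
        by (rule fsv_eqI) (simp add: nth G_scale[OF that] B.ap_scaleR scaleR_sum_right)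
      show "norm (v (mimag c)) = norm (v c)" if "c \<in> walg j" for c
      proof -
        have "(norm (v (mimag c)))\<^sup>2 = (norm (v c))\<^sup>2"
          unfolding norm_v G_imag[OF that] B.ap_scaleC
          by (simp add: norm_scaleC z flip: scaleC_sum_right)
        then show ?thesis by simp
      qed
      show "norm (v c) \<le> \<beta> * N" if "c \<in> walg j" "\<And>\<xi>. norm (A.op c \<xi>) \<le> norm \<xi>" for c
      proof (rule power2_le_imp_le)
        show "(norm (v c))\<^sup>2 \<le> (\<beta> * N)\<^sup>2"
          unfolding norm_v power_mult_distrib N by (rule matrix_boundD[OF bd[OF that]]) (use E in auto)
      qed (use \<beta> N in auto)
      show "(\<Sum>i<n. (norm (A.op (b i) \<xi>))\<^sup>2) \<le> K\<^sup>2 * (norm \<xi>)\<^sup>2" for \<xi>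
        by (rule A.col_bound_op[OF b col])
      show "(\<Sum>i<n. (norm (A.op (mstar (b i)) \<xi>))\<^sup>2) \<le> K\<^sup>2 * (norm \<xi>)\<^sup>2" for \<xi>
      proof (rule A.col_bound_op)
        show "col_bound n (widx j) (widx j) (\<lambda>i p q. A.ap (mstar (b i) p q)) K"
          by (rule col_bound_adjoint[OF row]) (use K in \<open>auto simp: mstar_def A.rinner_ap_star\<close>)
      qed (use b in \<open>auto intro: walg_mstar\<close>)
    qed (use b K in auto)
    then show ?thesis
      unfolding sum.cartesian_product' norm_v
      by (simp add: power_mult_distrib N mult_ac)
  qed
  then show "\<exists>F' D'. finite F' \<and> F \<subseteq> F' \<and> finite D' \<and> D \<subseteq> D' \<and>
      (\<forall>\<xi>. (\<Sum>p\<in>F'. (norm (\<Sum>q\<in>D'. (case p of (i, p) \<Rightarrow> \<lambda>q. B.ap (G (b i) p q)) q (\<xi> q)))\<^sup>2)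
         \<le> (sqrt 2 * \<beta> * K)\<^sup>2 * (\<Sum>q\<in>D'. (norm (\<xi> q))\<^sup>2))"
    using F D E by (intro exI[of _ "{..<n} \<times> E"] exI[of _ E]) auto
qed (auto simp: blinfun.zero_right)

lemma star_scaleR: "star (r *\<^sub>R x) = r *\<^sub>R star (x::'c::cstar_algebra)"
  using star_scaleC[of "complex_of_real r" x] by (simp add: scaleC_of_real)

text \<open>A row of \<open>G\<close> is the adjoint of a column of the map taking \<open>c\<close>
  to the adjoint of \<open>G c\<close>. That map is conjugate-linear when \<open>G\<close> is
  linear, whence \<open>cnj z\<close>.\<close>

lemma row_bound_image:
  fixes G :: "(nat list list, 'a) matr \<Rightarrow> ('e, 'b) matr"
  assumes E: "finite E"
    and G_add: "\<And>c d p q. c \<in> walg j \<Longrightarrow> d \<in> walg j \<Longrightarrow> G (c + d) p q = G c p q + G d p q"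
    and G_scale: "\<And>r c p q. c \<in> walg j \<Longrightarrow> G (r *\<^sub>R c) p q = r *\<^sub>R G c p q"
    and G_imag: "\<And>c p q. c \<in> walg j \<Longrightarrow> G (mimag c) p q = scaleC z (G c p q)" and z: "cmod z = 1"
    and bd: "\<And>c. c \<in> walg j \<Longrightarrow> (\<And>\<xi>. norm (A.op c \<xi>) \<le> norm \<xi>)
      \<Longrightarrow> matrix_bound E E (\<lambda>p q. B.ap (G c p q)) \<beta>"
    and \<beta>: "0 \<le> \<beta>"
    and b: "\<And>i. i < n \<Longrightarrow> b i \<in> walg j" and K: "0 < K"
    and col: "col_bound n (widx j) (widx j) (\<lambda>i p q. A.ap (b i p q)) K"
    and row: "row_bound n (widx j) (widx j) (\<lambda>i p q. A.ap (b i p q)) K"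
  shows "row_bound n E E (\<lambda>i p q. B.ap (G (b i) p q)) (sqrt 2 * \<beta> * K)"
proof -
  have "col_bound n E E (\<lambda>i p q. B.ap (star (G (b i) q p))) (sqrt 2 * \<beta> * K)"
  proof (rule col_bound_image[where G = "\<lambda>c p q. star (G c q p)" and z = "cnj z"])
    show "matrix_bound E E (\<lambda>p q. B.ap (star (G c q p))) \<beta>"
      if "c \<in> walg j" "\<And>\<xi>. norm (A.op c \<xi>) \<le> norm \<xi>" for c
      by (rule matrix_bound_adjoint[OF bd[OF that] \<beta>]) (simp_all add: B.rinner_ap_star)
  qed (use assms in \<open>auto simp: star_add star_scaleR star_scaleC\<close>)
  then show ?thesis
    by (rule row_bound_adjoint) (use \<beta> K in \<open>simp_all flip: B.rinner_ap_star add: star_star\<close>)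
qed

end

section \<open>Multi-indices\<close>

definition multi :: "nat \<Rightarrow> nat \<Rightarrow> nat list set" where
  "multi n j = {i. length i = j \<and> set i \<subseteq> {..<n}}"

lemma finite_multi [simp]: "finite (multi n j)"
  using finite_lists_length_eq[of "{..<n}" j] by (simp add: multi_def conj_commute)

lemma multi_0 [simp]: "multi n 0 = {[]}"
  by (auto simp: multi_def)

lemma sum_multi_Suc: "(\<Sum>i\<in>multi n (Suc j). f i) = (\<Sum>a<n. \<Sum>i\<in>multi n j. f (a # i))"
proof -
  have "multi n (Suc j) = (\<lambda>(a, i). a # i) ` ({..<n} \<times> multi n j)"
    by (auto simp: multi_def length_Suc_conv)
  then have "(\<Sum>i\<in>multi n (Suc j). f i) = (\<Sum>(a, i)\<in>{..<n} \<times> multi n j. f (a # i))"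
    by (simp add: sum.reindex inj_on_def o_def split_beta)
  then show ?thesis
    by (simp add: sum.cartesian_product)
qed

definition lrel :: "(nat \<Rightarrow> 'x \<Rightarrow> 'x \<Rightarrow> bool) \<Rightarrow> nat list \<Rightarrow> 'x list \<Rightarrow> 'x list \<Rightarrow> bool" where
  "lrel K i p q \<longleftrightarrow> (\<forall>r<length i. K (i ! r) (p ! r) (q ! r))"

lemma lrel_Nil [simp]: "lrel K [] p q"
  by (simp add: lrel_def)

lemma lrel_Cons [simp]: "lrel K (a # i) (x # p) (y # q) \<longleftrightarrow> K a x y \<and> lrel K i p q"
  by (simp add: lrel_def All_less_Suc2)

lemma E_index_Suc: "E_index n (Suc j) = (\<lambda>(x, p). x # p) ` (({..<n} <+> {..<n}) \<times> E_index n j)"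
  by (force simp: E_index_def length_Suc_conv)

lemma E_index_0 [simp]: "E_index n 0 = {[]}"
  by (auto simp: E_index_def)

lemma finite_E_index [simp]: "finite (E_index n k)"
  using finite_lists_length_eq[of "{..<n} <+> {..<n}" k] by (simp add: E_index_def conj_commute)

text \<open>
  \<open>\<Sum> \<delta>\<^sub>i \<otimes> u(c\<^sub>i)\<close> over multi-indices \<open>i\<close>, where \<open>c\<^sub>i\<close> is the coefficient of \<open>c\<close> at the
  group element \<open>(g\<^bsub>i ! 0\<^esub>, g\<^bsub>i ! 1\<^esub>, \<dots>)\<close>, read off the column of the unit.
\<close>

definition slices :: "('a \<Rightarrow> 'b::real_vector) \<Rightarrow> nat \<Rightarrow> nat \<Rightarrow> (nat list list, 'a) matr \<Rightarrow> ((nat + nat) list, 'b) matr" where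
  "slices u n j c p q = (\<Sum>i\<in>multi n j. if lrel delta_rel i p q then u (c (map (\<lambda>a. [a]) i) (replicate j [])) else 0)"

lemma slices_Suc: "slices u n (Suc j) c (x # p) (y # q) =
    (\<Sum>a<n. if delta_rel a x y then slices u n j (\<lambda>p q. c ([a] # p) ([] # q)) p q else 0)"
  unfolding slices_def sum_multi_Suc by (intro sum.cong) (auto intro!: sum.cong sum.neutral)

lemma widx_Cons: "w # p \<in> widx (Suc j) \<longleftrightarrow> distinct_adj w \<and> p \<in> widx j"
  by (auto simp: widx_def All_less_Suc2)

lemma shift_Cons: "shift (Suc r) l (w # p) = w # shift r l p"
  by (simp add: shift_def)

lemma rcfin_inj:
  assumes "rcfin c" "inj f" "inj g"
  shows "rcfin (\<lambda>p q. c (f p) (g q))"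
proof -
  have "{q. c (f p) (g q) \<noteq> 0} = g -` {q. c (f p) q \<noteq> 0}" "{p. c (f p) (g q) \<noteq> 0} = f -` {p. c p (g q) \<noteq> 0}" for p q
    by auto
  moreover have "finite {q. c (f p) q \<noteq> 0}" "finite {p. c p (g q) \<noteq> 0}" for p q
    using assms(1) by (auto simp: rcfin_def)
  ultimately show ?thesis
    using assms(2,3) unfolding rcfin_def by (metis finite_vimageI)
qed

text \<open>Translations of the remaining coordinates are translations of the original matrix that
  leave its first coordinate alone.\<close>

lemma walg_slice:
  assumes c: "c \<in> walg (Suc j)" and w: "distinct_adj w" "distinct_adj w'"
  shows "(\<lambda>p q. c (w # p) (w' # q)) \<in> walg j"
  unfolding walg_def
proof (intro CollectI conjI allI impI ballI)
  show "rcfin (\<lambda>p q. c (w # p) (w' # q))"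
    using walgD(1)[OF c] by (rule rcfin_inj) (auto simp: inj_on_def)
  show "p \<in> widx j" "q \<in> widx j" if "c (w # p) (w' # q) \<noteq> 0" for p q
    using walgD(2,3)[OF c that] by (auto simp: widx_Cons)
  show "c (w # shift r l p) (w' # shift r l q) = c (w # p) (w' # q)"
    if "r < j" "p \<in> widx j" "q \<in> widx j" for r l p q
    using walgD(4)[OF c, of "Suc r" "w # p" "w' # q" l] that w by (simp add: widx_Cons shift_Cons)
qed

text \<open>Right translation by the involution \<open>g\<^sub>a\<close> exchanges the words \<open>[]\<close> and \<open>[a]\<close>.\<close>

lemma walg_swap:
  assumes c: "c \<in> walg (Suc j)" and pq: "p \<in> widx j" "q \<in> widx j"
  shows "c ([] # p) ([a] # q) = c ([a] # p) ([] # q)"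
  using walgD(4)[OF c, of 0 "[a] # p" "[] # q" a] pq by (simp add: widx_Cons shift_def rmul_def)

section \<open>Norm of the coefficient maps on the group algebra\<close>

context bounded_map
begin

lemma u_simps: "u 0 = 0" "u (x + y) = u x + u y" "u (r *\<^sub>R x) = r *\<^sub>R u x" "u (scaleC c x) = scaleC c (u x)"
  "u (sum f S) = (\<Sum>i\<in>S. u (f i))"
  using u by (auto simp: bounded_clinear_def linear_simps bounded_linear.linear linear_sum)

lemma norm_u: "norm (u x) \<le> onorm u * norm x"
  using u onorm[of u] by (simp add: bounded_clinear_def)

lemma onorm_u: "0 \<le> onorm u"
  using u by (simp add: bounded_clinear_def onorm_pos_le)

lemma slices_linear:
  "slices u n j (c + d) p q = slices u n j c p q + slices u n j d p q"
  "slices u n j (r *\<^sub>R c) p q = r *\<^sub>R slices u n j c p q"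
  "slices u n j (mimag c) p q = scaleC \<i> (slices u n j c p q)"
  unfolding slices_def sum.distrib[symmetric] scaleR_sum_right scaleC_sum_right
  by (intro sum.cong; simp add: u_simps mimag_def)+

text \<open>The map from A[G^j] to \<open>E_n^j\<close> tensor B that sends \<open>c\<close> to the
  sum of \<open>\<delta>\<close>-tensors with coefficients u(c_i) has norm at most
  \<open>\<beta>\<close>.\<close>

definition slices_bound :: "nat \<Rightarrow> nat \<Rightarrow> real \<Rightarrow> bool" where
  "slices_bound n j \<beta> \<longleftrightarrow> (\<forall>c\<in>walg j. (\<forall>\<xi>. norm (A.op c \<xi>) \<le> norm \<xi>) \<longrightarrow>
     matrix_bound (E_index n j) (E_index n j) (\<lambda>p q. B.ap (slices u n j c p q)) \<beta>)"

lemma col_row_slices: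
  assumes bd: "slices_bound n j \<beta>" and \<beta>: "0 \<le> \<beta>"
    and b: "\<And>i. i < n \<Longrightarrow> b i \<in> walg j" and K: "0 < K"
    and col: "col_bound n (widx j) (widx j) (\<lambda>i p q. A.ap (b i p q)) K"
    and row: "row_bound n (widx j) (widx j) (\<lambda>i p q. A.ap (b i p q)) K"
  shows "col_bound n (E_index n j) (E_index n j) (\<lambda>i p q. B.ap (slices u n j (b i) p q)) (sqrt 2 * \<beta> * K)"
    and "row_bound n (E_index n j) (E_index n j) (\<lambda>i p q. B.ap (slices u n j (b i) p q)) (sqrt 2 * \<beta> * K)"
proof -
  have bd': "matrix_bound (E_index n j) (E_index n j) (\<lambda>p q. B.ap (slices u n j c p q)) \<beta>"
    if "c \<in> walg j" "\<And>\<xi>. norm (A.op c \<xi>) \<le> norm \<xi>" for c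
    using bd that by (simp add: slices_bound_def)
  show "col_bound n (E_index n j) (E_index n j) (\<lambda>i p q. B.ap (slices u n j (b i) p q)) (sqrt 2 * \<beta> * K)"
    by (rule col_bound_image[OF finite_E_index slices_linear _ bd' \<beta> b K col row]) simp_all
  show "row_bound n (E_index n j) (E_index n j) (\<lambda>i p q. B.ap (slices u n j (b i) p q)) (sqrt 2 * \<beta> * K)"
    by (rule row_bound_image[OF finite_E_index slices_linear _ bd' \<beta> b K col row]) simp_all
qed

text \<open>\<open>M\<close> is left free for two uses: in the induction it is \<open>slices\<close>
  at the next level, and at the end it is the amplification of the given element.\<close>

lemma delta_slices:
  assumes "0 < n" and bd: "slices_bound n j \<beta>" and \<beta>: "0 \<le> \<beta>"
    and b: "\<And>i. i < n \<Longrightarrow> b i \<in> walg j" and K: "0 < K"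
    and col: "col_bound n (widx j) (widx j) (\<lambda>i p q. A.ap (b i p q)) K"
    and row: "row_bound n (widx j) (widx j) (\<lambda>i p q. A.ap (b i p q)) K"
    and M: "\<And>x y p q. M (x # p) (y # q) = (\<Sum>a<n. if delta_rel a x y then slices u n j (b a) p q else 0)"
  shows "matrix_bound (E_index n (Suc j)) (E_index n (Suc j)) (\<lambda>p q. B.ap (M p q)) (sqrt 2 * \<beta> * K)"
proof -
  let ?E = "({..<n} <+> {..<n}) \<times> E_index n j"
  have *: "matrix_bound ?E ?E (kernel_matrix n delta_rel (\<lambda>i p q. B.ap (slices u n j (b i) p q))) (sqrt 2 * \<beta> * K)"
    by (rule delta_of_col_row[OF _ \<open>0 < n\<close> col_row_slices[OF bd \<beta> b K col row]])
      (simp add: blinfun.zero_right)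
  show ?thesis
    by (rule matrix_bound_reindex[OF *, of "\<lambda>p. (hd p, tl p)" _ "\<lambda>p. (hd p, tl p)"])
      (auto simp: inj_on_def E_index_Suc M kernel_matrix_def fun_eq_iff B.ap_sum intro!: sum.cong)
qed

lemma slices_bound_0: "slices_bound n 0 (onorm u)"
  unfolding slices_bound_def
proof (intro ballI impI)
  fix c :: "(nat list list, 'a) matr" assume c: "c \<in> walg 0" and bd: "\<forall>\<xi>. norm (A.op c \<xi>) \<le> norm \<xi>"
  have mb: "matrix_bound {[]} {[]} (\<lambda>p q. A.ap (c p q)) 1"
    by (rule A.matrix_bound_of_op[OF walgD(1)[OF c]]) (use bd in simp)
  have "norm (A.ap (c [] []) \<xi>) \<le> 1 * norm \<xi>" for \<xi>
    using matrix_boundD[OF mb, of "{[]}" "{[]}" "\<lambda>_. \<xi>"] by simp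
  then have "norm (c [] []) \<le> 1"
    by (rule A.norm_le_of_ap) simp
  then have "norm (u (c [] [])) \<le> onorm u"
    using norm_u[of "c [] []"] mult_left_mono[OF _ onorm_u, of "norm (c [] [])" 1] by simp
  then have le: "norm (B.ap (u (c [] [])) \<xi>) \<le> onorm u * norm \<xi>" for \<xi>
    by (intro order_trans[OF B.norm_ap_le mult_right_mono]) simp_all
  show "matrix_bound (E_index n 0) (E_index n 0) (\<lambda>p q. B.ap (slices u n 0 c p q)) (onorm u)"
  proof (rule matrix_boundI)
    fix F D :: "(nat + nat) list set"
    assume "F \<subseteq> E_index n 0" "D \<subseteq> E_index n 0"
    then show "\<exists>F' D'. finite F' \<and> F \<subseteq> F' \<and> finite D' \<and> D \<subseteq> D' \<and>
      (\<forall>\<xi>. (\<Sum>p\<in>F'. (norm (\<Sum>q\<in>D'. B.ap (slices u n 0 c p q) (\<xi> q)))\<^sup>2)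
         \<le> (onorm u)\<^sup>2 * (\<Sum>q\<in>D'. (norm (\<xi> q))\<^sup>2))"
      using power_mono[OF le norm_ge_zero, of _ 2]
      by (intro exI[of _ "{[]}"]) (simp add: slices_def power_mult_distrib)
  qed (simp add: blinfun.zero_right)
qed

text \<open>The column and the row of coefficients are submatrices of \<open>c\<close> itself, so
  they have bound 1 and a step costs only the \<open>sqrt 2\<close> of the inequality; the factor 2
  is paid solely for lifting into the group algebra.\<close>

lemma slices_bound_Suc:
  assumes n: "0 < n" and bd: "slices_bound n j \<beta>" and \<beta>: "0 \<le> \<beta>"
  shows "slices_bound n (Suc j) (sqrt 2 * \<beta>)"
  unfolding slices_bound_def
proof (intro ballI impI)
  fix c :: "(nat list list, 'a) matr"
  assume c: "c \<in> walg (Suc j)" and op: "\<forall>\<xi>. norm (A.op c \<xi>) \<le> norm \<xi>"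
  define b where "b a = (\<lambda>p q. c ([a] # p) ([] # q))" for a
  have mb: "matrix_bound (widx (Suc j)) (widx (Suc j)) (\<lambda>p q. A.ap (c p q)) 1"
    by (rule A.matrix_bound_of_op[OF walgD(1)[OF c]]) (use op in simp)
  have col: "col_bound n (widx j) (widx j) (\<lambda>i p q. A.ap (b i p q)) 1"
    unfolding col_bound_def
    by (rule matrix_bound_reindex[OF mb, of "\<lambda>(a, p). [a] # p" _ "\<lambda>p. [] # p"])
      (auto simp: inj_on_def widx_Cons b_def)
  have row: "row_bound n (widx j) (widx j) (\<lambda>i p q. A.ap (b i p q)) 1"
    unfolding row_bound_def
    by (rule matrix_bound_reindex[OF mb, of "\<lambda>p. [] # p" _ "\<lambda>(a, p). [a] # p"])
      (auto simp: inj_on_def widx_Cons b_def walg_swap[OF c])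
  have b: "b a \<in> walg j" for a
    unfolding b_def by (rule walg_slice[OF c]) auto
  have M: "slices u n (Suc j) c (x # p) (y # q)
      = (\<Sum>a<n. if delta_rel a x y then slices u n j (b a) p q else 0)" for x y p q
    unfolding slices_Suc b_def ..
  show "matrix_bound (E_index n (Suc j)) (E_index n (Suc j))
      (\<lambda>p q. B.ap (slices u n (Suc j) c p q)) (sqrt 2 * \<beta>)"
    using delta_slices[OF n bd \<beta> b zero_less_one col row M] by simp
qed

lemma slices_bound:
  assumes "0 < n"
  shows "slices_bound n j (sqrt 2 ^ j * onorm u)"
proof (induction j)
  case (Suc j)
  then show ?case
    using slices_bound_Suc[OF assms Suc] onorm_u by (simp add: mult.assoc)
qed (simp add: slices_bound_0)

end

section \<open>Replacing one tensor factor at a time\<close>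

fun mixed_rel :: "nat \<Rightarrow> (nat + nat) + nat list \<Rightarrow> (nat + nat) + nat list \<Rightarrow> bool" where
  "mixed_rel i (Inl x) (Inl y) = delta_rel i x y"
| "mixed_rel i (Inr w) (Inr w') = word_rel i w w'"
| "mixed_rel i _ _ = False"

text \<open>Each position of an index may hold either kind of basis label. All stages are thus
  submatrices of one matrix with fixed coefficients \<open>a\<close>.\<close>

definition mixed :: "nat \<Rightarrow> nat \<Rightarrow> (nat list \<Rightarrow> 'a::real_vector) \<Rightarrow> (((nat + nat) + nat list) list, 'a) matr" where
  "mixed n k a P Q = (\<Sum>i\<in>multi n k. if lrel mixed_rel i P Q then a i else 0)"

text \<open>The first \<open>s\<close> tensor factors are still \<open>\<delta>\<close>'s, the others have become group elements.\<close>

definition stage :: "nat \<Rightarrow> nat \<Rightarrow> nat \<Rightarrow> ((nat + nat) + nat list) list set" where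
  "stage n k s = {P. length P = k \<and> (\<forall>r<k. if r < s then P ! r \<in> Inl ` ({..<n} <+> {..<n})
      else P ! r \<in> Inr ` {w. distinct_adj w})}"

text \<open>Isolates position \<open>s\<close>: the inner sum depends on \<open>P\<close> and
  \<open>Q\<close> only away from \<open>s\<close>, and so is the same coefficient whether position
  \<open>s\<close> carries a \<open>\<delta>\<close> or a group element.\<close>

lemma mixed_expand:
  assumes "s < k"
  shows "mixed n k a P Q = (\<Sum>a0<n. if mixed_rel a0 (P ! s) (Q ! s)
     then \<Sum>i\<in>multi n k. if i ! s = a0 \<and> (\<forall>r<k. r \<noteq> s \<longrightarrow> mixed_rel (i ! r) (P ! r) (Q ! r)) then a i else 0
     else 0)"
proof -
  have "(\<Sum>a0<n. if mixed_rel a0 (P ! s) (Q ! s)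
     then \<Sum>i\<in>multi n k. if i ! s = a0 \<and> (\<forall>r<k. r \<noteq> s \<longrightarrow> mixed_rel (i ! r) (P ! r) (Q ! r)) then a i else 0
     else 0) = (\<Sum>a0<n. \<Sum>i\<in>multi n k. if a0 = i ! s then if lrel mixed_rel i P Q then a i else 0 else 0)"
    using assms by (intro sum.cong refl) (auto simp: multi_def lrel_def intro!: sum.cong sum.neutral)
  also have "\<dots> = (\<Sum>i\<in>multi n k. if lrel mixed_rel i P Q then a i else 0)"
  proof (subst sum.swap, rule sum.cong)
    fix i assume "i \<in> multi n k"
    then have "i ! s \<in> {..<n}"
      using assms subsetD[OF _ nth_mem, of i "{..<n}" s] by (simp add: multi_def)
    then show "(\<Sum>a0<n. if a0 = i ! s then if lrel mixed_rel i P Q then a i else 0 else 0)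
        = (if lrel mixed_rel i P Q then a i else 0)"
      by simp
  qed simp
  finally show ?thesis
    by (simp add: mixed_def)
qed

context embedded
begin

lemma mixed_step:
  assumes n: "0 < n" and s: "s < k"
    and bd: "matrix_bound (stage n k (Suc s)) (stage n k (Suc s)) (\<lambda>P Q. ap (mixed n k a P Q)) C"
  shows "matrix_bound (stage n k s) (stage n k s) (\<lambda>P Q. ap (mixed n k a P Q)) (2 * C)"
proof -
  define e where "e a0 P Q = (\<Sum>i\<in>multi n k.
      if i ! s = a0 \<and> (\<forall>r<k. r \<noteq> s \<longrightarrow> mixed_rel (i ! r) (P ! r) (Q ! r)) then a i else 0)" for a0 P Q
  define b where "b a0 P Q = ap (e a0 P Q)" for a0 P Q
  have e_update: "e a0 (P[s := x]) (Q[s := y]) = e a0 P Q" for a0 P Q x y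
    unfolding e_def by (intro sum.cong) auto
  \<comment> \<open>\<open>Inr []\<close> is a placeholder: by \<open>e_update\<close> the
    coefficients ignore position \<open>s\<close>, so cleared indices can label the other
    factors.\<close>
  define clear where "clear P = P[s := Inr []]" for P :: "((nat + nat) + nat list) list"
  define J where "J = clear ` stage n k s"
  have J: "length R = k" "R[s := Inr []] = R" if "R \<in> J" for R
    using that by (auto simp: J_def clear_def stage_def)
  have J_stage: "R[s := Inl d] \<in> stage n k (Suc s)" if R: "R \<in> J" and d: "d \<in> {..<n} <+> {..<n}" for R d
  proof -
    obtain P where "P \<in> stage n k s" "R = P[s := Inr []]"
      using R by (auto simp: J_def clear_def)
    then show ?thesis
      using d s by (auto simp: stage_def nth_list_update split: if_splits)
  qed
  have inj: "inj_on (\<lambda>(d, R). R[s := Inl d]) (({..<n} <+> {..<n}) \<times> J)"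
  proof (rule inj_onI, clarify)
    fix d R d' R' assume R: "R \<in> J" "R' \<in> J" and eq: "R[s := Inl d] = R'[s := Inl d']"
    have "R = R'"
      using arg_cong[OF eq, of "\<lambda>P. P[s := Inr []]"] J[OF R(1)] J[OF R(2)] by simp
    moreover have "d = d'"
      using arg_cong[OF eq, of "\<lambda>P. P ! s"] J[OF R(1)] J[OF R(2)] s by simp
    ultimately show "d = d' \<and> R = R'" by simp
  qed
  let ?E = "({..<n} <+> {..<n}) \<times> J"
  have delta: "matrix_bound ?E ?E (kernel_matrix n delta_rel b) C"
  proof (rule matrix_bound_reindex[OF bd inj inj])
    fix p q assume pq: "p \<in> ?E" "q \<in> ?E"
    obtain d R d' R' where p: "p = (d, R)" and q: "q = (d', R')"
      by (cases p; cases q)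
    have len: "length R = k" "length R' = k"
      using pq J(1) by (auto simp: p q)
    show "kernel_matrix n delta_rel b p q
      = ap (mixed n k a (case p of (d, R) \<Rightarrow> R[s := Inl d]) (case q of (d, R) \<Rightarrow> R[s := Inl d]))"
      unfolding mixed_expand[OF s] e_def[symmetric] using s len
      by (auto simp: p q kernel_matrix_def b_def ap_sum e_update fun_eq_iff intro!: sum.cong)
  qed (use J_stage in auto)
  \<comment> \<open>The coefficients \<open>b\<close> are unchanged while their
    \<open>\<delta>\<close>'s become translations. The bound holds over all words and is then
    compressed to the reduced ones.\<close>
  have "matrix_bound (UNIV \<times> J) (UNIV \<times> J) (kernel_matrix n word_rel b) (2 * C)"
    by (rule word_of_col_row[OF _ col_row_of_delta[OF n delta]]) (simp add: b_def ap_right)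
  then show ?thesis
  proof (rule matrix_bound_reindex)
    let ?f = "\<lambda>P. (projr (P ! s), clear P)"
    have nth: "P ! s = Inr (projr (P ! s))" "length P = k" if "P \<in> stage n k s" for P
    proof -
      have "length P = k \<and> (\<forall>r<k. if r < s then P ! r \<in> Inl ` ({..<n} <+> {..<n})
          else P ! r \<in> Inr ` {w. distinct_adj w})"
        using that by (simp add: stage_def)
      then have "length P = k" "P ! s \<in> Inr ` {w. distinct_adj w}"
        using s by (metis less_irrefl)+
      then show "P ! s = Inr (projr (P ! s))" "length P = k"
        by auto
    qed
    show inj: "inj_on ?f (stage n k s)" "inj_on ?f (stage n k s)"
    proof -
      have "P = (clear P)[s := Inr (projr (P ! s))]" if "P \<in> stage n k s" for P
        using nth[OF that] by (metis clear_def list_update_id list_update_overwrite)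
      then show "inj_on ?f (stage n k s)"
        by (intro inj_onI) (metis Pair_inject)
      then show "inj_on ?f (stage n k s)" .
    qed
    show "?f ` stage n k s \<subseteq> UNIV \<times> J" "?f ` stage n k s \<subseteq> UNIV \<times> J"
      by (auto simp: J_def)
    fix P Q assume P: "P \<in> stage n k s" and Q: "Q \<in> stage n k s"
    have "mixed_rel i (P ! s) (Q ! s) = word_rel i (projr (P ! s)) (projr (Q ! s))" for i
      using nth(1)[OF P] nth(1)[OF Q] by (metis mixed_rel.simps(2))
    then show "ap (mixed n k a P Q) = kernel_matrix n word_rel b (?f P) (?f Q)"
      unfolding mixed_expand[OF s] e_def[symmetric]
      by (auto simp: kernel_matrix_def b_def ap_sum clear_def e_update fun_eq_iff intro!: sum.cong)
  qed
qed

lemma mixed_bound: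
  assumes n: "0 < n" and bd: "matrix_bound (stage n k k) (stage n k k) (\<lambda>P Q. ap (mixed n k a P Q)) C"
    and "m \<le> k"
  shows "matrix_bound (stage n k (k - m)) (stage n k (k - m)) (\<lambda>P Q. ap (mixed n k a P Q)) (2 ^ m * C)"
  using \<open>m \<le> k\<close>
proof (induction m)
  case (Suc m)
  then have "matrix_bound (stage n k (Suc (k - Suc m))) (stage n k (Suc (k - Suc m)))
      (\<lambda>P Q. ap (mixed n k a P Q)) (2 ^ m * C)"
    by (simp add: Suc_diff_Suc)
  from mixed_step[OF n _ this] Suc.prems show ?case
    by (simp add: mult.assoc)
qed (use bd in simp)

lemma min_norm_le:
  fixes x :: "('i, 'a) matr"
  assumes "finite I" "matrix_bound I I (\<lambda>p q. ap (x p q)) C" "0 \<le> C"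
  shows "min_norm I \<pi> x \<le> C"
  unfolding min_norm_def
proof (rule cSUP_least)
  have "(\<lambda>_. 0) \<in> {\<xi> :: 'i \<Rightarrow> 'h. L2_set (\<lambda>q. norm (\<xi> q)) I \<le> 1}"
    by (simp add: L2_set_def)
  then show "{\<xi> :: 'i \<Rightarrow> 'h. L2_set (\<lambda>q. norm (\<xi> q)) I \<le> 1} \<noteq> {}"
    by (rule ex_in_conv[THEN iffD1, OF exI])
  fix \<xi> :: "'i \<Rightarrow> 'h" assume "\<xi> \<in> {\<xi>. L2_set (\<lambda>q. norm (\<xi> q)) I \<le> 1}"
  then have le: "(\<Sum>q\<in>I. (norm (\<xi> q))\<^sup>2) \<le> 1"
    by (simp add: L2_set_def)
  have "(\<Sum>p\<in>I. (norm (\<Sum>q\<in>I. ap (x p q) (\<xi> q)))\<^sup>2) \<le> C\<^sup>2 * (\<Sum>q\<in>I. (norm (\<xi> q))\<^sup>2)"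
    by (rule matrix_boundD[OF assms(2)]) (use assms in auto)
  also have "\<dots> \<le> C\<^sup>2"
    by (rule mult_left_le[OF le]) simp
  finally show "L2_set (\<lambda>p. norm (\<Sum>q\<in>I. ap (x p q) (\<xi> q))) I \<le> C"
    unfolding L2_set_def by (intro real_le_lsqrt assms(3))
qed

lemma matrix_bound_of_min_norm:
  fixes x :: "('i, 'a) matr"
  assumes I: "finite I" and le: "min_norm I \<pi> x \<le> 1"
  shows "matrix_bound I I (\<lambda>p q. ap (x p q)) 1"
proof (rule matrix_boundI)
  define S where "S = {\<xi> :: 'i \<Rightarrow> 'h. L2_set (\<lambda>q. norm (\<xi> q)) I \<le> 1}"
  define T where "T \<xi> = L2_set (\<lambda>p. norm (\<Sum>q\<in>I. ap (x p q) (\<xi> q))) I" for \<xi>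
  \<comment> \<open>A real supremum dominates its members only for a bounded set; the sum of all
    entry norms is a crude bound.\<close>
  have "bdd_above (T ` S)"
  proof (rule bdd_aboveI2)
    fix \<xi> assume "\<xi> \<in> S"
    then have "norm (\<xi> q) \<le> 1" if "q \<in> I" for q
      using member_le_L2_set[OF I that, of "\<lambda>q. norm (\<xi> q)"] by (simp add: S_def)
    then have "norm (ap (x p q) (\<xi> q)) \<le> norm (x p q)" if "q \<in> I" for p q
      using norm_ap_le[of "x p q" "\<xi> q"] mult_left_le[of "norm (\<xi> q)" "norm (x p q)"] that
      by (meson norm_ge_zero order_trans)
    then have "norm (\<Sum>q\<in>I. ap (x p q) (\<xi> q)) \<le> (\<Sum>q\<in>I. norm (x p q))" for p
      by (intro sum_norm_le) auto
    then have "(\<Sum>p\<in>I. norm (\<Sum>q\<in>I. ap (x p q) (\<xi> q))) \<le> (\<Sum>p\<in>I. \<Sum>q\<in>I. norm (x p q))"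
      by (intro sum_mono)
    moreover have "T \<xi> \<le> (\<Sum>p\<in>I. norm (\<Sum>q\<in>I. ap (x p q) (\<xi> q)))"
      unfolding T_def by (rule L2_set_le_sum) auto
    ultimately show "T \<xi> \<le> (\<Sum>p\<in>I. \<Sum>q\<in>I. norm (x p q))"
      by linarith
  qed
  then have T1: "T \<xi> \<le> 1" if "\<xi> \<in> S" for \<xi>
    using cSUP_upper[OF that, of T] le unfolding min_norm_def S_def T_def by simp
  have main: "(\<Sum>p\<in>I. (norm (\<Sum>q\<in>I. ap (x p q) (\<xi> q)))\<^sup>2) \<le> 1\<^sup>2 * (\<Sum>q\<in>I. (norm (\<xi> q))\<^sup>2)" for \<xi>
  proof -
    define N where "N = L2_set (\<lambda>q. norm (\<xi> q)) I"
    show ?thesis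
    proof (cases "N = 0")
      case True
      then have "\<forall>q\<in>I. \<xi> q = 0"
        using I by (simp add: N_def L2_set_eq_0_iff)
      then show ?thesis
        by (simp add: ap_right)
    next
      case False
      then have N: "0 < N" using L2_set_nonneg[of "\<lambda>q. norm (\<xi> q)" I] by (simp add: N_def less_le)
      have "(\<lambda>q. (1 / N) *\<^sub>R \<xi> q) \<in> S"
        using N L2_set_right_distrib[of "1 / N" "\<lambda>q. norm (\<xi> q)" I] by (simp add: S_def N_def)
      then have "T (\<lambda>q. (1 / N) *\<^sub>R \<xi> q) \<le> 1"
        by (rule T1)
      moreover have "T (\<lambda>q. (1 / N) *\<^sub>R \<xi> q) = (1 / N) * T \<xi>"
        using N L2_set_right_distrib[of "1 / N" "\<lambda>p. norm (\<Sum>q\<in>I. ap (x p q) (\<xi> q))" I]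
        by (simp add: T_def ap_right flip: scaleR_sum_right)
      ultimately have "T \<xi> \<le> N"
        using N by (simp add: field_simps)
      then have "(T \<xi>)\<^sup>2 \<le> N\<^sup>2"
        by (intro power_mono) (auto simp: T_def L2_set_nonneg)
      then show ?thesis
        by (simp add: T_def N_def L2_set_def sum_nonneg)
    qed
  qed
  fix F D assume "F \<subseteq> I" "D \<subseteq> I"
  then show "\<exists>F' D'. finite F' \<and> F \<subseteq> F' \<and> finite D' \<and> D \<subseteq> D' \<and>
      (\<forall>\<xi>. (\<Sum>p\<in>F'. (norm (\<Sum>q\<in>D'. ap (x p q) (\<xi> q)))\<^sup>2) \<le> 1\<^sup>2 * (\<Sum>q\<in>D'. (norm (\<xi> q))\<^sup>2))"
    using I main by blast
qed (simp add: ap_right)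

end

section \<open>Coefficients of elements of the tensor product\<close>

lemma prod_sum_multi:
  fixes f :: "nat \<Rightarrow> nat \<Rightarrow> 'c::comm_semiring_1"
  shows "(\<Prod>r<k. \<Sum>a<n. f r a) = (\<Sum>i\<in>multi n k. \<Prod>r<k. f r (i ! r))"
proof (induction k arbitrary: f)
  case (Suc k)
  show ?case
    unfolding prod.lessThan_Suc_shift sum_multi_Suc
    by (simp add: Suc[of "\<lambda>r. f (Suc r)"] sum_product)
qed simp

text \<open>Expanding each factor in the \<open>\<delta>\<close>'s and multiplying out gives a sum
  over multi-indices; the product of their 0/1 entries is the indicator of
  \<open>lrel delta_rel\<close>.\<close>

lemma E_power_coeffs:
  assumes "Y \<in> E_power n k"
  shows "\<exists>\<eta>. Y = (\<lambda>p q. \<Sum>i\<in>multi n k. if lrel delta_rel i p q then \<eta> i else 0)"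
proof -
  obtain m :: nat and c X where Y: "Y = (\<lambda>p q. \<Sum>j<m. c j * pure_tensor k (X j) p q)"
    and X: "\<forall>j<m. \<forall>r<k. X j r \<in> E_space n"
    using assms by (auto simp: E_power_def)
  define g where "g j r = (SOME g. X j r = (\<lambda>p q. \<Sum>i<n. g i * delta i p q))" for j r
  have g: "X j r = (\<lambda>p q. \<Sum>i<n. g j r i * delta i p q)" if "j < m" "r < k" for j r
  proof -
    have "\<exists>g. X j r = (\<lambda>p q. \<Sum>i<n. g i * delta i p q)"
      using X that by (simp add: E_space_def)
    then show ?thesis
      unfolding g_def by (rule someI_ex)
  qed
  have "pure_tensor k (X j) p q = (\<Sum>i\<in>multi n k. if lrel delta_rel i p q then \<Prod>r<k. g j r (i ! r) else 0)"
    if "j < m" for j p q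
  proof -
    have "pure_tensor k (X j) p q = (\<Sum>i\<in>multi n k. \<Prod>r<k. g j r (i ! r) * delta (i ! r) (p ! r) (q ! r))"
      unfolding pure_tensor_def using that prod_sum_multi[of "\<lambda>r i. g j r i * delta i (p ! r) (q ! r)"]
      by (simp add: g)
    also have "\<dots> = (\<Sum>i\<in>multi n k. if lrel delta_rel i p q then \<Prod>r<k. g j r (i ! r) else 0)"
    proof (rule sum.cong)
      fix i assume "i \<in> multi n k"
      then have "length i = k" by (simp add: multi_def)
      then show "(\<Prod>r<k. g j r (i ! r) * delta (i ! r) (p ! r) (q ! r))
          = (if lrel delta_rel i p q then \<Prod>r<k. g j r (i ! r) else 0)"
      proof (cases "lrel delta_rel i p q")
        case True
        then show ?thesis
          using \<open>length i = k\<close> by (simp add: lrel_def delta_eq)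
      next
        case False
        then obtain r where "r < k" "\<not> delta_rel (i ! r) (p ! r) (q ! r)"
          using \<open>length i = k\<close> by (auto simp: lrel_def)
        then have "(\<Prod>r<k. g j r (i ! r) * delta (i ! r) (p ! r) (q ! r)) = 0"
          by (intro prod_zero bexI[of _ r]) (simp_all add: delta_eq)
        then show ?thesis
          using False by simp
      qed
    qed simp
    finally show ?thesis .
  qed
  then have "Y p q = (\<Sum>j<m. \<Sum>i\<in>multi n k. if lrel delta_rel i p q then c j * (\<Prod>r<k. g j r (i ! r)) else 0)" for p q
    unfolding Y by (intro sum.cong) (auto simp: sum_distrib_left intro!: sum.cong)
  then have "Y p q = (\<Sum>i\<in>multi n k. if lrel delta_rel i p q then \<Sum>j<m. c j * (\<Prod>r<k. g j r (i ! r)) else 0)" for p q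
    by (subst (asm) sum.swap) (auto intro!: sum.cong)
  then show ?thesis
    by (intro exI[of _ "\<lambda>i. \<Sum>j<m. c j * (\<Prod>r<k. g j r (i ! r))"] ext)
qed

lemma tensor_space_coeffs:
  fixes x :: "((nat + nat) list, 'a::complex_vector) matr"
  assumes "x \<in> tensor_space (E_power n k)"
  shows "\<exists>a. x = (\<lambda>p q. \<Sum>i\<in>multi n k. if lrel delta_rel i p q then a i else 0)"
proof -
  obtain m :: nat and Y and a :: "nat \<Rightarrow> 'a" where x: "x = (\<lambda>p q. \<Sum>j<m. tensor (Y j) (a j) p q)"
    and Y: "\<forall>j<m. Y j \<in> E_power n k"
    using assms by (auto simp: tensor_space_def)
  define \<eta> where "\<eta> j = (SOME \<eta>. Y j = (\<lambda>p q. \<Sum>i\<in>multi n k. if lrel delta_rel i p q then \<eta> i else 0))" for j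
  have \<eta>: "Y j = (\<lambda>p q. \<Sum>i\<in>multi n k. if lrel delta_rel i p q then \<eta> j i else 0)" if "j < m" for j
    unfolding \<eta>_def by (rule someI_ex[OF E_power_coeffs[OF Y[rule_format, OF that]]])
  have "x p q = (\<Sum>j<m. \<Sum>i\<in>multi n k. if lrel delta_rel i p q then scaleC (\<eta> j i) (a j) else 0)" for p q
    unfolding x tensor_def by (intro sum.cong) (auto simp: \<eta> scaleC_sum_left intro!: sum.cong)
  then have "x p q = (\<Sum>i\<in>multi n k. if lrel delta_rel i p q then \<Sum>j<m. scaleC (\<eta> j i) (a j) else 0)" for p q
    by (subst (asm) sum.swap) (auto intro!: sum.cong)
  then show ?thesis
    by (intro exI[of _ "\<lambda>i. \<Sum>j<m. scaleC (\<eta> j i) (a j)"] ext)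
qed

context bounded_map
begin

text \<open>\<open>k\<close> counts the factors turned into group elements, one less than the tensor
  power. The constant collects \<open>2 ^ k\<close> for the lifting, \<open>sqrt 2 ^ k\<close> for
  the lifted factors and one \<open>sqrt 2\<close> for the factor kept.\<close>

lemma amplify_bound:
  assumes n: "0 < n"
    and x: "\<And>p q. x p q = (\<Sum>i\<in>multi n (Suc k). if lrel delta_rel i p q then a i else 0)"
    and bd: "matrix_bound (E_index n (Suc k)) (E_index n (Suc k)) (\<lambda>p q. A.ap (x p q)) 1"
  shows "matrix_bound (E_index n (Suc k)) (E_index n (Suc k)) (\<lambda>p q. B.ap (amplify u x p q))
    (sqrt 2 * (sqrt 2 ^ k * onorm u) * 2 ^ k)"
proof -
  let ?S = "\<lambda>s. stage n (Suc k) s" and ?M = "\<lambda>P Q. A.ap (mixed n (Suc k) a P Q)"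
  have "matrix_bound (?S (Suc k)) (?S (Suc k)) ?M 1"
  proof (rule matrix_bound_reindex[OF bd])
    have stage: "P = map Inl (map projl P)" "map projl P \<in> E_index n (Suc k)" if "P \<in> ?S (Suc k)" for P
    proof -
      have P: "length P = Suc k" "\<And>r. r < Suc k \<Longrightarrow> P ! r \<in> Inl ` ({..<n} <+> {..<n})"
        using that by (auto simp: stage_def)
      then have nth: "P ! r = Inl (projl (P ! r))" "projl (P ! r) \<in> {..<n} <+> {..<n}" if "r < Suc k" for r
        using that by force+
      show "P = map Inl (map projl P)"
        by (rule nth_equalityI) (use P nth in auto)
      show "map projl P \<in> E_index n (Suc k)"
        using P(1) nth(2) by (auto simp: E_index_def in_set_conv_nth)
    qed
    show inj: "inj_on (map projl) (?S (Suc k))" "inj_on (map projl) (?S (Suc k))"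
      using stage(1) by (metis inj_onI)+
    show "map projl ` ?S (Suc k) \<subseteq> E_index n (Suc k)" "map projl ` ?S (Suc k) \<subseteq> E_index n (Suc k)"
      using stage(2) by blast+
    fix P Q assume P: "P \<in> ?S (Suc k)" and Q: "Q \<in> ?S (Suc k)"
    have "lrel mixed_rel i P Q = lrel delta_rel i (map projl P) (map projl Q)" if "i \<in> multi n (Suc k)" for i
    proof -
      have "length i = Suc k" "length P = Suc k" "length Q = Suc k"
        using that P Q by (auto simp: multi_def stage_def)
      then have "lrel mixed_rel i (map Inl (map projl P)) (map Inl (map projl Q))
          = lrel delta_rel i (map projl P) (map projl Q)"
        by (simp add: lrel_def)
      then show ?thesis
        using stage(1)[OF P] stage(1)[OF Q] by simp
    qed
    then show "?M P Q = A.ap (x (map projl P) (map projl Q))"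
      by (simp add: x mixed_def cong: sum.cong)
  qed
  \<comment> \<open>The replacement stops at stage 1, after \<open>k\<close> of the
    \<open>Suc k\<close> factors.\<close>
  from A.mixed_bound[OF n this, of k] have st: "matrix_bound (?S (Suc 0)) (?S (Suc 0)) ?M (2 ^ k)"
    by simp
  \<comment> \<open>\<open>b a0\<close> is the group algebra element with coefficient
    \<open>a (a0 # i)\<close> at the product generator indexed by \<open>i\<close>, cut down to
    reduced words as \<open>walg\<close> demands.\<close>
  define b where "b a0 = (\<lambda>p q. if p \<in> widx k \<and> q \<in> widx k
      then \<Sum>i\<in>multi n k. if lrel word_rel i p q then a (a0 # i) else 0 else 0)" for a0
  let ?E = "({..<n} <+> {..<n}) \<times> widx k" and ?f = "\<lambda>(d, p). Inl d # map Inr p"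
  have "matrix_bound ?E ?E (kernel_matrix n delta_rel (\<lambda>i p q. A.ap (b i p q))) (2 ^ k)"
  proof (rule matrix_bound_reindex[OF st])
    show "inj_on ?f ?E" "inj_on ?f ?E"
      by (auto simp: inj_on_def inj_map_eq_map)
    have "?f z \<in> ?S (Suc 0)" if "z \<in> ?E" for z
      using that by (auto simp: stage_def widx_def All_less_Suc2)
    then show "?f ` ?E \<subseteq> ?S (Suc 0)" "?f ` ?E \<subseteq> ?S (Suc 0)"
      by blast+
    fix z z' assume zz: "z \<in> ?E" "z' \<in> ?E"
    obtain d p d' p' where z: "z = (d, p)" "z' = (d', p')"
      by (cases z; cases z')
    have p: "p \<in> widx k" "p' \<in> widx k"
      using zz z by auto
    have lrel: "lrel mixed_rel i (map Inr p) (map Inr p') = lrel word_rel i p p'" if "i \<in> multi n k" for i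
      using that p by (auto simp: lrel_def multi_def widx_def)
    have "mixed n (Suc k) a (?f z) (?f z') = (\<Sum>a0<n. if delta_rel a0 d d' then b a0 p p' else 0)"
      unfolding mixed_def sum_multi_Suc b_def
      using p by (intro sum.cong refl) (auto simp: z lrel intro!: sum.cong sum.neutral)
    then show "kernel_matrix n delta_rel (\<lambda>i p q. A.ap (b i p q)) z z' = ?M (?f z) (?f z')"
      by (auto simp: z kernel_matrix_def A.ap_sum fun_eq_iff intro!: sum.cong)
  qed
  note cr = col_row_of_delta[OF n this]
  have b_walg: "b a0 \<in> walg k" for a0
    unfolding walg_def
  proof (intro CollectI conjI allI impI ballI)
    show "p \<in> widx k" "q \<in> widx k" if "b a0 p q \<noteq> 0" for p q
      using that by (auto simp: b_def split: if_splits)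
    have rel: "\<exists>i\<in>multi n k. lrel word_rel i p q \<and> length p = k \<and> length q = k" if "b a0 p q \<noteq> 0" for p q
    proof -
      have "p \<in> widx k" "q \<in> widx k" "(\<Sum>i\<in>multi n k. if lrel word_rel i p q then a (a0 # i) else 0) \<noteq> 0"
        using that by (auto simp: b_def split: if_splits)
      moreover from sum.not_neutral_contains_not_neutral[OF this(3)]
      have "\<exists>i\<in>multi n k. lrel word_rel i p q"
        by metis
      ultimately show ?thesis
        by (auto simp: widx_def)
    qed
    \<comment> \<open>A finite set containing every word one letter away from a word of
      \<open>p\<close>; since \<open>word_rel\<close> is symmetric it bounds both rows and
      columns.\<close>
    define nbrs where "nbrs p = (\<Union>w\<in>set p. insert (tl w) ((\<lambda>i. i # w) ` {..<n}))" for p :: "nat list list"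
    have "set q \<subseteq> nbrs p"
      if rel: "lrel word_rel i p q" and i: "i \<in> multi n k" and len: "length p = k" "length q = k" for i p q
    proof
      fix w assume "w \<in> set q"
      then obtain r where r: "r < k" "w = q ! r"
        using len by (auto simp: in_set_conv_nth)
      have "i ! r \<in> {..<n}"
        using r(1) i subsetD[OF _ nth_mem, of i "{..<n}" r] by (simp add: multi_def)
      moreover have "word_rel (i ! r) (p ! r) w"
        using rel i r by (auto simp: lrel_def multi_def)
      moreover have "p ! r \<in> set p"
        using r len by simp
      ultimately show "w \<in> nbrs p"
        unfolding nbrs_def word_rel_def by force
    qed
    moreover have "lrel word_rel i q p" if "lrel word_rel i p q" for i p q
      using that word_rel_sym by (auto simp: lrel_def)
    ultimately have "{q. b a0 p q \<noteq> 0} \<subseteq> {q. set q \<subseteq> nbrs p \<and> length q = k}"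
      "{q. b a0 q p \<noteq> 0} \<subseteq> {q. set q \<subseteq> nbrs p \<and> length q = k}" for p
      using rel by blast+
    moreover have "finite {q. set q \<subseteq> nbrs p \<and> length q = k}" for p
      by (rule finite_lists_length_eq) (simp add: nbrs_def)
    ultimately show "rcfin (b a0)"
      unfolding rcfin_def by (meson finite_subset)
    fix r l p q assume r: "r < k" and p: "p \<in> widx k" and q: "q \<in> widx k"
    have "lrel word_rel i (shift r l p) (shift r l q) = lrel word_rel i p q" if "i \<in> multi n k" for i
    proof -
      have "word_rel (i ! s) (shift r l p ! s) (shift r l q ! s) = word_rel (i ! s) (p ! s) (q ! s)"
        if "s < k" for s
        using p q r that word_rel_rmul[of "p ! s" "q ! s"]
        by (cases "s = r") (auto simp: shift_def widx_def)
      then show ?thesis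
        using that by (auto simp: lrel_def multi_def)
    qed
    then show "b a0 (shift r l p) (shift r l q) = b a0 p q"
      using p q shift_in[OF _ r] by (simp add: b_def cong: sum.cong)
  qed
  \<comment> \<open>Against the unit, only the multi-index \<open>i\<close> itself is related to the
    tuple of one-letter words, so \<open>slices\<close> recovers the original coefficients.\<close>
  have b_val: "b a0 (map (\<lambda>a. [a]) i) (replicate k []) = a (a0 # i)" if i: "i \<in> multi n k" for a0 i
  proof -
    have "lrel word_rel i' (map (\<lambda>a. [a]) i) (replicate k []) \<longleftrightarrow> i' = i" if "i' \<in> multi n k" for i'
      using that i by (auto simp: lrel_def multi_def word_rel_def intro: nth_equalityI)
    moreover have "map (\<lambda>a. [a]) i \<in> widx k" "replicate k [] \<in> widx k"
      using i by (auto simp: widx_def multi_def)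
    ultimately show ?thesis
      using i by (simp add: b_def cong: sum.cong)
  qed
  have M: "amplify u x (d # p) (d' # q) = (\<Sum>a0<n. if delta_rel a0 d d' then slices u n k (b a0) p q else 0)"
    for d d' p q
    unfolding amplify_def x sum_multi_Suc slices_def u_simps
    by (intro sum.cong refl) (auto simp: u_simps b_val intro!: sum.cong sum.neutral)
  show ?thesis
    by (rule delta_slices[OF n slices_bound[OF n] _ b_walg _ cr M]) (simp_all add: onorm_u)
qed

end

theorem proposition0:
  fixes u :: "'a::cstar_algebra \<Rightarrow> 'b::cstar_algebra"
    and \<pi> :: "'a \<Rightarrow> ('h::complex_hilbert \<Rightarrow>\<^sub>L 'h)"
    and \<rho> :: "'b \<Rightarrow> ('g::complex_hilbert \<Rightarrow>\<^sub>L 'g)"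
    and k n :: nat
  assumes "cstar_embedding \<pi>" and "cstar_embedding \<rho>"
    and "bounded_clinear u"
    and "k \<ge> 1" and "n \<ge> 1"
  shows "map_norm (tensor_space (E_power n k))
           (min_norm (E_index n k) \<pi>) (min_norm (E_index n k) \<rho>) (amplify u)
         \<le> ereal (2 powr (3 * real k / 2 - 1) * onorm u)"
proof -
  interpret bounded_map \<pi> \<rho> u
    using assms by unfold_locales
  obtain k' where k: "k = Suc k'"
    using \<open>k \<ge> 1\<close> by (cases k) auto
  \<comment> \<open>With k = k' + 1 the exponent splits as 1/2 + k'/2 + k', matching the three
    factors of \<open>amplify_bound\<close>.\<close>
  have "2 powr (3 * real k / 2 - 1) = 2 powr (1/2) * (2 powr (1/2)) powr real k' * 2 powr real k'"
    by (simp add: k powr_powr add_divide_distrib add.commute flip: powr_add)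
  also have "\<dots> = sqrt 2 * sqrt 2 ^ k' * 2 ^ k'"
    by (simp add: powr_half_sqrt powr_realpow)
  finally have const: "2 powr (3 * real k / 2 - 1) * onorm u = sqrt 2 * (sqrt 2 ^ k' * onorm u) * 2 ^ k'"
    by simp
  have "min_norm (E_index n k) \<rho> (amplify u x) \<le> 2 powr (3 * real k / 2 - 1) * onorm u"
    if x: "x \<in> tensor_space (E_power n k)" and le: "min_norm (E_index n k) \<pi> x \<le> 1" for x
  proof -
    obtain a where a: "x = (\<lambda>p q. \<Sum>i\<in>multi n k. if lrel delta_rel i p q then a i else 0)"
      using tensor_space_coeffs[OF x] by blast
    have "matrix_bound (E_index n k) (E_index n k) (\<lambda>p q. B.ap (amplify u x p q))
        (sqrt 2 * (sqrt 2 ^ k' * onorm u) * 2 ^ k')"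
      unfolding k
    proof (rule amplify_bound)
      show "x p q = (\<Sum>i\<in>multi n (Suc k'). if lrel delta_rel i p q then a i else 0)" for p q
        by (simp add: a k)
      show "matrix_bound (E_index n (Suc k')) (E_index n (Suc k')) (\<lambda>p q. A.ap (x p q)) 1"
        using A.matrix_bound_of_min_norm[OF finite_E_index le] by (simp add: k)
    qed (use \<open>n \<ge> 1\<close> in simp)
    then show ?thesis
      unfolding const by (rule B.min_norm_le[OF finite_E_index]) (simp add: onorm_u)
  qed
  then show ?thesis
    unfolding map_norm_def by (intro SUP_least) auto
qed

end
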